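(* Let $\rho^{ab}$ be a state on $\mathcal H_a\otimes\mathcal H_b$ and fix an orthonormal basis $\{|i\rangle\}_{i=1}^{n_a}$ of $\mathcal H_a$. Let $\eta_i=\mathrm{Tr}\big[(|i\rangle\langle i|\otimes I^b)\rho^{ab}\big]$ and, for $\eta_i>0$, $\omega_i=\eta_i^{-1}\sqrt{\rho^{ab}}\,(|i\rangle\langle i|\otimes I^b)\sqrt{\rho^{ab}}$. Then $$C^a_F(\rho^{ab})=P^{opt(vN)}_E(\{\omega_i,\eta_i\}),$$ and consequently $C^a_F(\rho^{ab})\ge P^{opt}_E(\{\omega_i,\eta_i\})$. Moreover, if the states $\{\omega_i:\eta_i>0\}$ are linearly independent, then $C^a_F(\rho^{ab})=P^{opt}_E(\{\omega_i,\eta_i\})$.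
   Context: $\mathcal H_a,\mathcal H_b$ are finite-dimensional with $\dim\mathcal H_a=n_a$. The set of partial incoherent states (with respect to the Lüders measurement $\{|i\rangle\langle i|\otimes I^b\}$) is $I^a_P=\{\sigma:\sum_i(|i\rangle\langle i|\otimes I^b)\sigma(|i\rangle\langle i|\otimes I^b)=\sigma\}$, i.e. the states of the form $\sum_ip_i|i\rangle\langle i|\otimes\sigma_i$. The fidelity partial coherence is $C^a_F(\rho^{ab})=\min_{\sigma\in I^a_P}\big(1-F^2(\rho^{ab},\sigma)\big)$ with $F(\rho,\sigma)=\mathrm{Tr}\sqrt{\sqrt\sigma\rho\sqrt\sigma}$. For an ensemble $\{\rho_i,\eta_i\}$ (states $\rho_i$ with prior probabilities $\eta_i$), $P^{opt}_S=\max_{\{M_i\}}\sum_i\eta_i\mathrm{Tr}(M_i\rho_i)$ over all POVMs $\{M_i\}$, $P^{opt}_E=1-P^{opt}_S$, and $P^{opt(vN)}_E$ is defined in the same way but with the maximization restricted to von Neumann measurements, i.e. families of mutually orthogonal projectors $\{\pi_i\}$ (one per index, possibly zero) summing to the identity. States $\{\rho_i\}$ with spectral decompositions $\rho_i=\sum_j\lambda_{ij}|\psi_{ij}\rangle\langle\psi_{ij}|$ ($\lambda_{ij}>0$) are called linearly independent if the whole collection of vectors $\{|\psi_{ij}\rangle\}_{i,j}$ is linearly independent. *)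

theory Defs
  imports "Jordan_Normal_Form.Matrix" "Jordan_Normal_Form.Conjugate"
begin

text \<open>Finite-dimensional quantum states are complex matrices. The bipartite space
H_a (x) H_b with dim H_a = na, dim H_b = nb is C^(na*nb), the index r corresponding
to the product basis element (r div nb, r mod nb) (Kronecker convention).\<close>

definition cadj :: "complex mat \<Rightarrow> complex mat" where
  "cadj A = mat (dim_col A) (dim_row A) (\<lambda>(i,j). cnj (A $$ (j,i)))"

definition mtrace :: "complex mat \<Rightarrow> complex" where
  "mtrace A = (\<Sum>i<dim_row A. A $$ (i,i))"

definition msum :: "nat \<Rightarrow> ('i \<Rightarrow> complex mat) \<Rightarrow> 'i set \<Rightarrow> complex mat" where
  "msum n f I = mat n n (\<lambda>(r,c). \<Sum>i\<in>I. f i $$ (r,c))"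

definition vsum :: "nat \<Rightarrow> ('i \<Rightarrow> complex vec) \<Rightarrow> 'i set \<Rightarrow> complex vec" where
  "vsum n f I = vec n (\<lambda>k. \<Sum>i\<in>I. f i $ k)"

text \<open>Positive semidefinite n x n matrix (over C this forces Hermiticity; we state it anyway).\<close>
definition psd :: "nat \<Rightarrow> complex mat \<Rightarrow> bool" where
  "psd n A \<longleftrightarrow> A \<in> carrier_mat n n \<and> cadj A = A \<and>
     (\<forall>v \<in> carrier_vec n. 0 \<le> conjugate v \<bullet> (A *\<^sub>v v))"

definition density :: "nat \<Rightarrow> complex mat \<Rightarrow> bool" where
  "density n \<rho> \<longleftrightarrow> psd n \<rho> \<and> mtrace \<rho> = 1"

definition msqrt :: "nat \<Rightarrow> complex mat \<Rightarrow> complex mat" where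
  "msqrt n A = (THE B. psd n B \<and> B * B = A)"

definition fidelity :: "nat \<Rightarrow> complex mat \<Rightarrow> complex mat \<Rightarrow> real" where
  "fidelity n \<rho> \<sigma> = Re (mtrace (msqrt n (msqrt n \<sigma> * \<rho> * msqrt n \<sigma>)))"

definition kron :: "complex mat \<Rightarrow> complex mat \<Rightarrow> complex mat" where
  "kron A B = mat (dim_row A * dim_row B) (dim_col A * dim_col B)
     (\<lambda>(r,c). A $$ (r div dim_row B, c div dim_col B) * B $$ (r mod dim_row B, c mod dim_col B))"

definition outer :: "complex vec \<Rightarrow> complex vec \<Rightarrow> complex mat" where
  "outer v w = mat (dim_vec v) (dim_vec w) (\<lambda>(i,j). v $ i * cnj (w $ j))"

definition orthonormal_basis :: "nat \<Rightarrow> (nat \<Rightarrow> complex vec) \<Rightarrow> bool" where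
  "orthonormal_basis n e \<longleftrightarrow> (\<forall>i<n. e i \<in> carrier_vec n) \<and>
     (\<forall>i<n. \<forall>j<n. e i \<bullet>c e j = (if i = j then 1 else 0))"

definition lproj :: "nat \<Rightarrow> (nat \<Rightarrow> complex vec) \<Rightarrow> nat \<Rightarrow> complex mat" where
  "lproj nb e i = kron (outer (e i) (e i)) (1\<^sub>m nb)"

definition partial_incoherent :: "nat \<Rightarrow> nat \<Rightarrow> (nat \<Rightarrow> complex vec) \<Rightarrow> complex mat set" where
  "partial_incoherent na nb e = {\<sigma>. density (na*nb) \<sigma> \<and>
     msum (na*nb) (\<lambda>i. lproj nb e i * \<sigma> * lproj nb e i) {..<na} = \<sigma>}"

text \<open>C^a_F(rho) = min over partial incoherent sigma of 1 - F^2 (the min is attained; written as Inf).\<close>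
definition fid_partial_coherence :: "nat \<Rightarrow> nat \<Rightarrow> (nat \<Rightarrow> complex vec) \<Rightarrow> complex mat \<Rightarrow> real" where
  "fid_partial_coherence na nb e \<rho> =
     Inf ((\<lambda>\<sigma>. 1 - (fidelity (na*nb) \<rho> \<sigma>)\<^sup>2) ` partial_incoherent na nb e)"

definition povm :: "nat \<Rightarrow> nat \<Rightarrow> (nat \<Rightarrow> complex mat) \<Rightarrow> bool" where
  "povm n m M \<longleftrightarrow> (\<forall>i<m. psd n (M i)) \<and> msum n M {..<m} = 1\<^sub>m n"

definition vn_measurement :: "nat \<Rightarrow> nat \<Rightarrow> (nat \<Rightarrow> complex mat) \<Rightarrow> bool" where
  "vn_measurement n m M \<longleftrightarrow> (\<forall>i<m. M i \<in> carrier_mat n n \<and> cadj (M i) = M i \<and> M i * M i = M i) \<and>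
     (\<forall>i<m. \<forall>j<m. i \<noteq> j \<longrightarrow> M i * M j = 0\<^sub>m n n) \<and> msum n M {..<m} = 1\<^sub>m n"

definition succ_prob :: "nat \<Rightarrow> (nat \<Rightarrow> real) \<Rightarrow> (nat \<Rightarrow> complex mat) \<Rightarrow> (nat \<Rightarrow> complex mat) \<Rightarrow> real" where
  "succ_prob m \<eta> \<omega> M = (\<Sum>i<m. \<eta> i * Re (mtrace (M i * \<omega> i)))"

definition opt_error :: "nat \<Rightarrow> nat \<Rightarrow> (nat \<Rightarrow> real) \<Rightarrow> (nat \<Rightarrow> complex mat) \<Rightarrow> real" where
  "opt_error n m \<eta> \<omega> = 1 - Sup ((\<lambda>M. succ_prob m \<eta> \<omega> M) ` {M. povm n m M})"

definition opt_error_vN :: "nat \<Rightarrow> nat \<Rightarrow> (nat \<Rightarrow> real) \<Rightarrow> (nat \<Rightarrow> complex mat) \<Rightarrow> real" where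
  "opt_error_vN n m \<eta> \<omega> = 1 - Sup ((\<lambda>M. succ_prob m \<eta> \<omega> M) ` {M. vn_measurement n m M})"

definition lin_indep_states :: "nat \<Rightarrow> nat set \<Rightarrow> (nat \<Rightarrow> complex mat) \<Rightarrow> bool" where
  "lin_indep_states n S \<omega> \<longleftrightarrow> (\<exists>(r :: nat \<Rightarrow> nat) (\<psi> :: nat \<Rightarrow> nat \<Rightarrow> complex vec) (lam :: nat \<Rightarrow> nat \<Rightarrow> real).
     (\<forall>i\<in>S. (\<forall>j<r i. \<psi> i j \<in> carrier_vec n \<and> lam i j > 0) \<and>
        (\<forall>j<r i. \<forall>k<r i. \<psi> i j \<bullet>c \<psi> i k = (if j = k then 1 else 0)) \<and>
        \<omega> i = msum n (\<lambda>j. complex_of_real (lam i j) \<cdot>\<^sub>m outer (\<psi> i j) (\<psi> i j)) {..<r i}) \<and>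
     (\<forall>c :: nat \<times> nat \<Rightarrow> complex.
        vsum n (\<lambda>(i,j). c (i,j) \<cdot>\<^sub>v \<psi> i j) {(i,j). i \<in> S \<and> j < r i} = 0\<^sub>v n \<longrightarrow>
        (\<forall>i\<in>S. \<forall>j<r i. c (i,j) = 0)))"

definition eta_ens :: "nat \<Rightarrow> (nat \<Rightarrow> complex vec) \<Rightarrow> complex mat \<Rightarrow> nat \<Rightarrow> real" where
  "eta_ens nb e \<rho> i = Re (mtrace (lproj nb e i * \<rho>))"

definition omega_ens :: "nat \<Rightarrow> nat \<Rightarrow> (nat \<Rightarrow> complex vec) \<Rightarrow> complex mat \<Rightarrow> nat \<Rightarrow> complex mat" where
  "omega_ens na nb e \<rho> i =
     (if eta_ens nb e \<rho> i > 0
      then complex_of_real (1 / eta_ens nb e \<rho> i) \<cdot>\<^sub>m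
             (msqrt (na*nb) \<rho> * lproj nb e i * msqrt (na*nb) \<rho>)
      else 0\<^sub>m (na*nb) (na*nb))"

end

theory Submission
  imports Defs "Jordan_Normal_Form.Schur_Decomposition"
begin

text \<open>Write R = sqrt rho, T = sqrt sigma and P_i for the Lueders projectors. If sigma is
  partially incoherent then T commutes with every P_i. For a unitary U with U R T positive this
  gives F = Tr (U R T) = Tr (Y T) with Y = sum_i P_i U R P_i, so by Cauchy-Schwarz F^2 is at most
  the squared Hilbert-Schmidt norm of Y, which is the success probability of the von Neumann
  measurement U* P_i U.

  Conversely, for any POVM M put K_i = sqrt M_i R P_i, take unitaries U_i with U_i K_i positive,
  and let T be the normalised sum of the U_i K_i. Then T^2 is partially incoherent, and
  C = sum_i P_i U_i sqrt M_i is a contraction for which Tr (C R T) is the square root of the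
  success probability of M; hence F^2 is at least that probability. So the optima over
  incoherent states, von Neumann measurements and POVMs all coincide.\<close>

text \<open>Both sides reduce to squared Hilbert-Schmidt norms. The fidelity is the trace norm of R
  T, which some unitary attains and no contraction exceeds, while the success term Tr (M_i R P_i R)
  is the squared norm of K_i = sqrt M_i R P_i. The choice of T is suggested by equality in the
  Cauchy-Schwarz step: T should be proportional to a matrix of positive diagonal blocks, and the
  absolute value of K_i has the right norm and is supported by P_i on both sides. For a general POVM
  the matrix C need not be unitary, so the lower bound on the fidelity is proved for contractions;
  that C contracts comes from the completeness of the POVM. In the circle of inequalities state and
  measurement change at every turn, so it closes at the level of infima and suprema. A preliminary
  obstacle is that \<open>msqrt\<close> is a definite description: existence and uniqueness of
  positive roots have to be established before a fidelity can be computed, and both rest on a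
  spectral theorem obtained by comparing traces.\<close>

section \<open>Adjoints, traces and entrywise formulas\<close>

lemma cadj_carrier [simp]: "A \<in> carrier_mat n m \<Longrightarrow> cadj A \<in> carrier_mat m n"
  unfolding cadj_def by auto

lemma cadj_index: "A \<in> carrier_mat n m \<Longrightarrow> i < m \<Longrightarrow> j < n \<Longrightarrow> cadj A $$ (i,j) = cnj (A $$ (j,i))"
  unfolding cadj_def by auto

lemma cadj_cadj [simp]: "cadj (cadj A) = A"
  unfolding cadj_def by (rule eq_matI) auto

lemma cadj_one [simp]: "cadj (1\<^sub>m n) = 1\<^sub>m n"
  unfolding cadj_def by (rule eq_matI) auto

lemma mult_index:
  assumes "A \<in> carrier_mat n m" "B \<in> carrier_mat m k" "i < n" "j < k"
  shows "(A * B) $$ (i,j) = (\<Sum>l<m. A $$ (i,l) * B $$ (l,j))"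
  using assms by (auto simp: scalar_prod_def atLeast0LessThan intro!: sum.cong)

lemma mult_vec_index:
  assumes "A \<in> carrier_mat n m" "v \<in> carrier_vec m" "i < n"
  shows "(A *\<^sub>v v) $ i = (\<Sum>l<m. A $$ (i,l) * v $ l)"
  using assms by (auto simp: scalar_prod_def atLeast0LessThan intro!: sum.cong)

lemma cscalar_prod_sum:
  fixes v w :: "complex vec"
  assumes "w \<in> carrier_vec n"
  shows "v \<bullet>c w = (\<Sum>i<n. v $ i * cnj (w $ i))"
  using assms by (auto simp: scalar_prod_def atLeast0LessThan intro!: sum.cong)

lemma cadj_mult:
  assumes "A \<in> carrier_mat n m" "B \<in> carrier_mat m k"
  shows "cadj (A * B) = cadj B * cadj A"
proof (rule eq_matI)
  fix i j assume "i < dim_row (cadj B * cadj A)" "j < dim_col (cadj B * cadj A)"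
  with assms have ij: "i < k" "j < n" by (auto simp: cadj_def)
  have AB: "A * B \<in> carrier_mat n k" using assms by auto
  have "cadj (A * B) $$ (i,j) = cnj (\<Sum>l<m. A $$ (j,l) * B $$ (l,i))"
    using cadj_index[OF AB ij] mult_index[OF assms ij(2) ij(1)] by simp
  also have "\<dots> = (\<Sum>l<m. cadj B $$ (i,l) * cadj A $$ (l,j))"
    using assms ij by (auto simp: cadj_index[of _ n m] cadj_index[of _ m k] mult.commute intro!: sum.cong)
  also have "\<dots> = (cadj B * cadj A) $$ (i,j)"
    using mult_index[of "cadj B" k m "cadj A" n i j] assms ij by simp
  finally show "cadj (A * B) $$ (i,j) = (cadj B * cadj A) $$ (i,j)" .
qed (use assms in \<open>auto simp: cadj_def\<close>)

lemma mtrace_eq: "A \<in> carrier_mat n m \<Longrightarrow> mtrace A = (\<Sum>i<n. A $$ (i,i))"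
  unfolding mtrace_def by auto

lemma mtrace_comm:
  assumes "A \<in> carrier_mat n m" "B \<in> carrier_mat m n"
  shows "mtrace (A * B) = mtrace (B * A)"
proof -
  have AB: "A * B \<in> carrier_mat n n" "B * A \<in> carrier_mat m m" using assms by auto
  have "mtrace (A * B) = (\<Sum>i<n. \<Sum>l<m. A $$ (i,l) * B $$ (l,i))"
    unfolding mtrace_eq[OF AB(1)] by (intro sum.cong refl, subst mult_index[OF assms]) auto
  also have "\<dots> = (\<Sum>l<m. \<Sum>i<n. B $$ (l,i) * A $$ (i,l))"
    by (subst sum.swap) (simp add: mult.commute)
  also have "\<dots> = mtrace (B * A)"
    unfolding mtrace_eq[OF AB(2)]
    by (intro sum.cong refl, subst mult_index[OF assms(2,1)]) auto
  finally show ?thesis .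
qed

lemma mtrace_cadj:
  assumes "A \<in> carrier_mat n n" shows "mtrace (cadj A) = cnj (mtrace A)"
  using assms by (auto simp: mtrace_eq[of _ n n] cadj_index[of _ n n])

text \<open>Schur triangularisation puts the roots of the characteristic polynomial on the diagonal,
  and similarity preserves the trace. The search for a new eigenvalue thereby becomes a comparison
  of traces.\<close>

lemma mtrace_eq_sum_list_eigenvalues:
  assumes A: "A \<in> carrier_mat n n" and cp: "char_poly A = (\<Prod>a\<leftarrow>es. [:- a, 1:])"
  shows "mtrace A = sum_list es"
proof -
  obtain B P Q where sd: "schur_decomposition A es = (B,P,Q)" by (cases "schur_decomposition A es") auto
  from schur_decomposition[OF A cp sd]
  have sim: "similar_mat_wit A B P Q" and dg: "diag_mat B = es" by auto
  note w = similar_mat_witD2[OF A sim]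
  have "mtrace A = mtrace (P * (B * Q))" using w by simp
  also have "\<dots> = mtrace ((B * Q) * P)" by (rule mtrace_comm) (use w in auto)
  also have "(B * Q) * P = B" using w by (simp add: assoc_mult_mat[of _ n n _ n _ n])
  also have "mtrace B = sum_list (diag_mat B)"
    unfolding mtrace_def diag_mat_def
    by (simp add: sum.list_conv_set_nth interv_sum_list_conv_sum_set_nat atLeast0LessThan)
  finally show ?thesis using dg by simp
qed

lemma hermitian_cscalar_prod:
  assumes A: "A \<in> carrier_mat n n" "cadj A = A" and v: "v \<in> carrier_vec n" and w: "w \<in> carrier_vec n"
  shows "(A *\<^sub>v v) \<bullet>c w = v \<bullet>c (A *\<^sub>v w)"
proof -
  have sym: "cnj (A $$ (j,i)) = A $$ (i,j)" if "i < n" "j < n" for i j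
    using cadj_index[OF A(1) that] A(2) by simp
  have Aw: "A *\<^sub>v w \<in> carrier_vec n" using A(1) w by simp
  have "(A *\<^sub>v v) \<bullet>c w = (\<Sum>i<n. \<Sum>l<n. A $$ (i,l) * v $ l * cnj (w $ i))"
    unfolding cscalar_prod_sum[OF w]
    by (intro sum.cong refl, subst mult_vec_index[OF A(1) v]) (auto simp: sum_distrib_right)
  also have "\<dots> = (\<Sum>l<n. \<Sum>i<n. v $ l * cnj (A $$ (l,i) * w $ i))"
    by (subst sum.swap) (auto intro!: sum.cong simp: sym)
  also have "\<dots> = v \<bullet>c (A *\<^sub>v w)"
    unfolding cscalar_prod_sum[OF Aw]
    by (intro sum.cong refl, subst mult_vec_index[OF A(1) w]) (auto simp: sum_distrib_left)
  finally show ?thesis .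
qed

subsection \<open>Hermitian matrices and orthonormal eigenvectors\<close>

text \<open>The index set J is arbitrary so that the vectors of a partial family keep their
  positions when the family is completed.\<close>

definition orthonormal_eigenvectors ::
  "nat \<Rightarrow> complex mat \<Rightarrow> nat set \<Rightarrow> (nat \<Rightarrow> complex vec) \<Rightarrow> (nat \<Rightarrow> real) \<Rightarrow> bool" where
  "orthonormal_eigenvectors n A J v d \<longleftrightarrow>
     (\<forall>j\<in>J. v j \<in> carrier_vec n \<and> A *\<^sub>v v j = complex_of_real (d j) \<cdot>\<^sub>v v j) \<and>
     (\<forall>j\<in>J. \<forall>k\<in>J. v j \<bullet>c v k = (if j = k then 1 else 0))"

text \<open>Replacing the known eigenvalues by the imaginary unit produces a matrix whose trace has
  imaginary part card J < n, so it has an eigenvalue other than the imaginary unit, whose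
  eigenvector is orthogonal to the known ones. For A = 0 this completes an orthonormal family.\<close>
lemma hermitian_next_eigenvector:
  assumes A: "A \<in> carrier_mat n n" "cadj A = A" and J: "J \<subset> {..<n}"
    and ev: "orthonormal_eigenvectors n A J v d"
  obtains u r where "u \<in> carrier_vec n" "u \<bullet>c u = 1" "\<And>j. j \<in> J \<Longrightarrow> u \<bullet>c v j = 0"
    "A *\<^sub>v u = complex_of_real r \<cdot>\<^sub>v u"
proof -
  have finJ: "finite J" using J finite_subset by blast
  have v: "v j \<in> carrier_vec n" "A *\<^sub>v v j = complex_of_real (d j) \<cdot>\<^sub>v v j" if "j \<in> J" for j
    using ev that unfolding orthonormal_eigenvectors_def by auto
  have on: "v j \<bullet>c v k = (if j = k then 1 else 0)" if "j \<in> J" "k \<in> J" for j k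
    using ev that unfolding orthonormal_eigenvectors_def by auto
  \<comment> \<open>The rank-one corrections make A + D send each v_j to \<i> v_j. The d_j and the
    trace of the Hermitian A are real, so the imaginary part of the trace counts J.\<close>
  define D where "D = mat n n (\<lambda>(a,b). \<Sum>j\<in>J. (\<i> - d j) * v j $ a * cnj (v j $ b))"
  define B where "B = A + D"
  have D: "D \<in> carrier_mat n n" and B: "B \<in> carrier_mat n n" using A by (auto simp: D_def B_def)
  have Du: "D *\<^sub>v u = vec n (\<lambda>a. \<Sum>j\<in>J. (\<i> - d j) * v j $ a * (u \<bullet>c v j))"
    if u: "u \<in> carrier_vec n" for u
  proof (rule eq_vecI)
    fix a assume "a < dim_vec (vec n (\<lambda>a. \<Sum>j\<in>J. (\<i> - d j) * v j $ a * (u \<bullet>c v j)))"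
    then have a: "a < n" by simp
    have "(D *\<^sub>v u) $ a = (\<Sum>b<n. \<Sum>j\<in>J. (\<i> - d j) * v j $ a * cnj (v j $ b) * u $ b)"
      unfolding mult_vec_index[OF D u a] using a
      by (auto simp: D_def sum_distrib_right intro!: sum.cong)
    also have "\<dots> = (\<Sum>j\<in>J. (\<i> - d j) * v j $ a * (u \<bullet>c v j))"
      by (subst sum.swap) (auto intro!: sum.cong simp: cscalar_prod_sum[OF v(1)] sum_distrib_left)
    finally show "(D *\<^sub>v u) $ a = vec n (\<lambda>a. \<Sum>j\<in>J. (\<i> - d j) * v j $ a * (u \<bullet>c v j)) $ a"
      using a by simp
  qed (use D in auto)
  have "mtrace D = (\<Sum>j\<in>J. (\<i> - d j) * (v j \<bullet>c v j))"
    unfolding mtrace_eq[OF D]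
    by (simp add: D_def, subst sum.swap)
      (auto intro!: sum.cong simp: cscalar_prod_sum[OF v(1)] sum_distrib_left)
  also have "\<dots> = (\<Sum>j\<in>J. \<i> - d j)" using on by (auto intro!: sum.cong)
  finally have "Im (mtrace D) = card J" by simp
  moreover have "Im (mtrace A) = 0"
    using arg_cong[OF mtrace_cadj[OF A(1)], of Im] A(2) by simp
  moreover have "mtrace B = mtrace A + mtrace D"
    using A D by (auto simp: B_def mtrace_eq[of _ n n] sum.distrib)
  ultimately have ImB: "Im (mtrace B) = card J" by simp
  obtain es where es: "char_poly B = (\<Prod>a\<leftarrow>es. [:- a, 1:])" "length es = n"
    using char_poly_factorized[OF B] by auto
  have "\<exists>l\<in>set es. l \<noteq> \<i>"
  proof (rule ccontr)
    assume "\<not> (\<exists>l\<in>set es. l \<noteq> \<i>)"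
    then have "es = replicate n \<i>" using es(2) by (intro replicate_eqI) auto
    then have "mtrace B = of_nat n * \<i>"
      using mtrace_eq_sum_list_eigenvalues[OF B es(1)] by (simp add: sum_list_replicate)
    then have "card J = n" using ImB by simp
    then show False using J psubset_card_mono[OF _ J] by simp
  qed
  then obtain l where l: "l \<in> set es" "l \<noteq> \<i>" by auto
  have "poly (char_poly B) l = 0" unfolding es(1) using l(1)
    by (auto simp: poly_prod_list prod_list_zero_iff)
  then have "eigenvalue B l" using eigenvalue_root_char_poly[OF B] by simp
  then obtain u where u: "u \<in> carrier_vec n" "u \<noteq> 0\<^sub>v n" "B *\<^sub>v u = l \<cdot>\<^sub>v u"
    unfolding eigenvalue_def eigenvector_def using B by auto
  have Bu: "B *\<^sub>v u = A *\<^sub>v u + D *\<^sub>v u"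
    unfolding B_def by (rule add_mult_distrib_mat_vec[OF A(1) D u(1)])
  \<comment> \<open>Paired with v_j, A contributes the factor d_j and D the factor \<i> - d_j; so l
    and \<i> have the same product with the inner product of u and v_j, which must vanish. Hence D
    annihilates u, and u is an eigenvector of A itself.\<close>
  have orth: "u \<bullet>c v j = 0" if j: "j \<in> J" for j
  proof -
    have "(D *\<^sub>v u) \<bullet>c v j = (\<Sum>a<n. \<Sum>k\<in>J. (\<i> - d k) * v k $ a * (u \<bullet>c v k) * cnj (v j $ a))"
      unfolding cscalar_prod_sum[OF v(1)[OF j]] Du[OF u(1)] by (auto simp: sum_distrib_right)
    also have "\<dots> = (\<Sum>k\<in>J. (\<i> - d k) * (u \<bullet>c v k) * (v k \<bullet>c v j))"
      by (subst sum.swap) (auto intro!: sum.cong simp: cscalar_prod_sum[OF v(1)[OF j], of "v _"] sum_distrib_left mult_ac)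
    also have "\<dots> = (\<Sum>k\<in>J. if k = j then (\<i> - d j) * (u \<bullet>c v j) else 0)"
      using on j by (auto intro!: sum.cong)
    also have "\<dots> = (\<i> - d j) * (u \<bullet>c v j)" using finJ j by simp
    finally have 1: "(D *\<^sub>v u) \<bullet>c v j = (\<i> - d j) * (u \<bullet>c v j)" .
    have 2: "(A *\<^sub>v u) \<bullet>c v j = d j * (u \<bullet>c v j)"
      unfolding hermitian_cscalar_prod[OF A u(1) v(1)[OF j]] v(2)[OF j] using u(1) v(1)[OF j]
      by (auto simp: cscalar_prod_sum[of _ n] sum_distrib_left mult_ac intro!: sum.cong)
    have "l * (u \<bullet>c v j) = (B *\<^sub>v u) \<bullet>c v j"
      unfolding u(3) using u(1) v(1)[OF j] by simp
    also have "\<dots> = (A *\<^sub>v u) \<bullet>c v j + (D *\<^sub>v u) \<bullet>c v j"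
      unfolding Bu using A(1) D u(1) v(1)[OF j]
      by (intro add_scalar_prod_distrib[of _ n]) auto
    also have "\<dots> = \<i> * (u \<bullet>c v j)" unfolding 1 2 by (simp add: algebra_simps)
    finally show ?thesis using l(2) by simp
  qed
  have Au: "A *\<^sub>v u = l \<cdot>\<^sub>v u"
  proof -
    have "D *\<^sub>v u = 0\<^sub>v n" unfolding Du[OF u(1)] by (rule eq_vecI) (auto simp: orth)
    then show ?thesis using Bu u(3) A(1) u(1) by simp
  qed
  have uu0: "u \<bullet>c u \<noteq> 0" using u by (simp add: conjugate_square_eq_0_vec[OF u(1)])
  define s where "s = (\<Sum>i<n. (cmod (u $ i))\<^sup>2)"
  have uu: "u \<bullet>c u = complex_of_real s"
    unfolding cscalar_prod_sum[OF u(1)] s_def of_real_sum complex_norm_square ..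
  have "s \<noteq> 0" using uu0 unfolding uu by simp
  moreover have "s \<ge> 0" unfolding s_def by (simp add: sum_nonneg)
  ultimately have s: "s > 0" by simp
  have "l * (u \<bullet>c u) = cnj l * (u \<bullet>c u)"
    using hermitian_cscalar_prod[OF A u(1) u(1)] unfolding Au using u(1)
    by (simp add: cscalar_prod_sum[of _ n] sum_distrib_left mult_ac)
  then have "l = cnj l" using uu0 by simp
  then obtain r where r: "l = complex_of_real r" by (metis Reals_cases Reals_cnj_iff)
  define w where "w = complex_of_real (1 / sqrt s) \<cdot>\<^sub>v u"
  show ?thesis
  proof (rule that)
    show "w \<in> carrier_vec n" using u by (auto simp: w_def)
    then have "w \<bullet>c w = complex_of_real (1 / sqrt s) * complex_of_real (1 / sqrt s) * (u \<bullet>c u)"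
      using u(1) by (simp add: w_def cscalar_prod_sum[of _ n] sum_distrib_left mult_ac)
    also have "\<dots> = complex_of_real (1 / sqrt s * (1 / sqrt s) * s)" unfolding uu of_real_mult ..
    also have "1 / sqrt s * (1 / sqrt s) * s = 1" using s by simp
    finally show "w \<bullet>c w = 1" by simp
    show "w \<bullet>c v j = 0" if "j \<in> J" for j
      using orth[OF that] u(1) v(1)[OF that] by (simp add: w_def)
    show "A *\<^sub>v w = complex_of_real r \<cdot>\<^sub>v w"
      using Au A(1) u(1) unfolding w_def r
      by (simp add: mult_mat_vec[OF A(1) u(1)] smult_smult_assoc mult_ac)
  qed
qed

text \<open>Each induction step fills one missing index by
  \<open>hermitian_next_eigenvector\<close>. The empty J gives the spectral theorem; that v survives
  on J is what the polar decomposition requires.\<close>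

lemma extend_orthonormal_eigenvectors:
  assumes A: "A \<in> carrier_mat n n" "cadj A = A" and J: "J \<subseteq> {..<n}"
    and ev: "orthonormal_eigenvectors n A J v d"
  obtains v' d' where "orthonormal_eigenvectors n A {..<n} v' d'" "\<And>j. j \<in> J \<Longrightarrow> v' j = v j"
  using J ev
proof (induction "card ({..<n} - J)" arbitrary: J v d thesis)
  case 0
  then have "J = {..<n}" by auto
  then show ?case using 0 by blast
next
  case (Suc c)
  then have J: "J \<subset> {..<n}" by (metis Diff_cancel card.empty nat.distinct(1) psubsetI)
  then obtain m where m: "m < n" "m \<notin> J" by auto
  obtain u r where u: "u \<in> carrier_vec n" "u \<bullet>c u = 1" "\<And>j. j \<in> J \<Longrightarrow> u \<bullet>c v j = 0"
    "A *\<^sub>v u = complex_of_real r \<cdot>\<^sub>v u"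
    using hermitian_next_eigenvector[OF A J Suc.prems(3)] by metis
  have v: "v j \<in> carrier_vec n" if "j \<in> J" for j
    using Suc.prems(3) that unfolding orthonormal_eigenvectors_def by auto
  have u': "v j \<bullet>c u = 0" if "j \<in> J" for j
  proof -
    have "v j \<bullet>c u = cnj (u \<bullet>c v j)"
      using u(1) v[OF that] by (simp add: cscalar_prod_sum[of _ n] mult_ac)
    then show ?thesis using u(3)[OF that] by simp
  qed
  have card: "c = card ({..<n} - insert m J)"
  proof -
    have "{..<n} - J = insert m ({..<n} - insert m J)" using m by auto
    then have "card ({..<n} - J) = card (insert m ({..<n} - insert m J))" by (rule arg_cong)
    also have "\<dots> = Suc (card ({..<n} - insert m J))" by (rule card_insert_disjoint) auto
    finally show ?thesis using Suc.hyps(2) by linarith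
  qed
  have ev: "orthonormal_eigenvectors n A (insert m J) (v(m := u)) (d(m := r))"
    using Suc.prems(3) u u' m(2) unfolding orthonormal_eigenvectors_def by auto
  have sub: "insert m J \<subseteq> {..<n}" using Suc.prems(2) m by auto
  show ?case
  proof (rule Suc.hyps(1)[OF card _ sub ev])
    fix v' d' assume *: "orthonormal_eigenvectors n A {..<n} v' d'"
      "\<And>j. j \<in> insert m J \<Longrightarrow> v' j = (v(m := u)) j"
    show thesis by (rule Suc.prems(1)[OF *(1)]) (use *(2) m in auto)
  qed
qed

lemma conjugate_scalar_prod_eq:
  fixes v w :: "complex vec"
  assumes "v \<in> carrier_vec n" "w \<in> carrier_vec n"
  shows "conjugate v \<bullet> w = w \<bullet>c v"
  using assms by (intro comm_scalar_prod[of _ n]) auto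

lemma cscalar_prod_mult_mat_vec:
  assumes A: "A \<in> carrier_mat n n" and v: "v \<in> carrier_vec n"
  shows "conjugate v \<bullet> (A *\<^sub>v v) = (\<Sum>i<n. \<Sum>l<n. A $$ (i,l) * v $ l * cnj (v $ i))"
proof -
  have "A *\<^sub>v v \<in> carrier_vec n" using A v by simp
  then show ?thesis
    unfolding conjugate_scalar_prod_eq[OF v \<open>A *\<^sub>v v \<in> carrier_vec n\<close>] cscalar_prod_sum[OF v]
    by (intro sum.cong refl, subst mult_vec_index[OF A v]) (auto simp: sum_distrib_right)
qed

lemma msum_carrier [simp]: "msum n f I \<in> carrier_mat n n"
  unfolding msum_def by auto

section \<open>Hilbert-Schmidt norm, matrix sums and positivity in a fixed dimension\<close>

definition hs_norm2 :: "complex mat \<Rightarrow> real" where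
  "hs_norm2 X = Re (mtrace (cadj X * X))"

definition real_diag :: "nat \<Rightarrow> (nat \<Rightarrow> real) \<Rightarrow> complex mat" where
  "real_diag n d = mat n n (\<lambda>(i,j). if i = j then complex_of_real (d i) else 0)"

definition unitary_mat :: "nat \<Rightarrow> complex mat \<Rightarrow> bool" where
  "unitary_mat n U \<longleftrightarrow> U \<in> carrier_mat n n \<and> cadj U * U = 1\<^sub>m n \<and> U * cadj U = 1\<^sub>m n"

text \<open>With one fixed dimension, the carrier conditions of the matrix library become simp rules
  over \<open>Mn\<close>.\<close>

locale square_matrices =
  fixes n :: nat
begin

abbreviation Mn :: "complex mat set" where "Mn \<equiv> carrier_mat n n"

lemma mult_Mn [simp]: "A \<in> Mn \<Longrightarrow> B \<in> Mn \<Longrightarrow> A * B \<in> Mn"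
  by (rule mult_carrier_mat)

lemma add_Mn [simp]: "A \<in> Mn \<Longrightarrow> B \<in> Mn \<Longrightarrow> A + B \<in> Mn"
  by (rule add_carrier_mat)

lemma one_Mn [simp]: "A \<in> Mn \<Longrightarrow> A * 1\<^sub>m n = A" "A \<in> Mn \<Longrightarrow> 1\<^sub>m n * A = A"
  by (rule right_mult_one_mat, assumption) (rule left_mult_one_mat)

lemma zero_Mn [simp]: "A \<in> Mn \<Longrightarrow> A * 0\<^sub>m n n = 0\<^sub>m n n" "A \<in> Mn \<Longrightarrow> 0\<^sub>m n n * A = 0\<^sub>m n n"
  by (rule right_mult_zero_mat, assumption) (rule left_mult_zero_mat)

lemma add_index_Mn [simp]:
  "A \<in> Mn \<Longrightarrow> B \<in> Mn \<Longrightarrow> i < n \<Longrightarrow> j < n \<Longrightarrow> (A + B) $$ (i,j) = A $$ (i,j) + B $$ (i,j)"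
  by auto

lemma smult_index_Mn [simp]:
  "A \<in> Mn \<Longrightarrow> i < n \<Longrightarrow> j < n \<Longrightarrow> (c \<cdot>\<^sub>m A) $$ (i,j) = c * A $$ (i,j)"
  by auto

lemma assoc_Mn: "A \<in> Mn \<Longrightarrow> B \<in> Mn \<Longrightarrow> C \<in> Mn \<Longrightarrow> (A * B) * C = A * (B * C)"
  by (rule assoc_mult_mat)

lemma cadj_Mn: "A \<in> Mn \<Longrightarrow> B \<in> Mn \<Longrightarrow> cadj (A * B) = cadj B * cadj A"
  by (rule cadj_mult)

lemma mtrace_comm_Mn: "A \<in> Mn \<Longrightarrow> B \<in> Mn \<Longrightarrow> mtrace (A * B) = mtrace (B * A)"
  by (rule mtrace_comm)

lemma mult_index_Mn:
  "A \<in> Mn \<Longrightarrow> B \<in> Mn \<Longrightarrow> i < n \<Longrightarrow> j < n \<Longrightarrow> (A * B) $$ (i,j) = (\<Sum>l<n. A $$ (i,l) * B $$ (l,j))"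
  by (rule mult_index)

lemma mat_eqI: "A \<in> Mn \<Longrightarrow> B \<in> Mn \<Longrightarrow> (\<And>i j. i < n \<Longrightarrow> j < n \<Longrightarrow> A $$ (i,j) = B $$ (i,j)) \<Longrightarrow> A = B"
  by (intro eq_matI) auto

lemma msum_index: "i < n \<Longrightarrow> j < n \<Longrightarrow> msum n f I $$ (i,j) = (\<Sum>k\<in>I. f k $$ (i,j))"
  unfolding msum_def by simp

lemma msum_cong: "(\<And>k. k < (m::nat) \<Longrightarrow> f k = g k) \<Longrightarrow> msum n f {..<m} = msum n g {..<m}"
  unfolding msum_def by (intro cong_mat refl) (auto intro!: sum.cong)

lemma mult_msum:
  assumes "A \<in> Mn" "\<And>k. k < (m::nat) \<Longrightarrow> f k \<in> Mn"
  shows "A * msum n f {..<m} = msum n (\<lambda>k. A * f k) {..<m}"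
proof (rule mat_eqI)
  fix i j assume ij: "i < n" "j < n"
  have "(A * msum n f {..<m}) $$ (i,j) = (\<Sum>l<n. \<Sum>k<m. A $$ (i,l) * f k $$ (l,j))"
    by (subst mult_index_Mn) (use assms ij in \<open>auto simp: msum_index sum_distrib_left\<close>)
  also have "\<dots> = (\<Sum>k<m. (A * f k) $$ (i,j))"
    by (subst sum.swap) (use assms ij in \<open>auto intro!: sum.cong simp: mult_index_Mn\<close>)
  finally show "(A * msum n f {..<m}) $$ (i,j) = msum n (\<lambda>k. A * f k) {..<m} $$ (i,j)" using ij by (simp add: msum_index)
qed (use assms in auto)

lemma msum_mult:
  assumes "A \<in> Mn" "\<And>k. k < (m::nat) \<Longrightarrow> f k \<in> Mn"
  shows "msum n f {..<m} * A = msum n (\<lambda>k. f k * A) {..<m}"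
proof (rule mat_eqI)
  fix i j assume ij: "i < n" "j < n"
  have "(msum n f {..<m} * A) $$ (i,j) = (\<Sum>l<n. \<Sum>k<m. f k $$ (i,l) * A $$ (l,j))"
    by (subst mult_index_Mn) (use assms ij in \<open>auto simp: msum_index sum_distrib_right\<close>)
  also have "\<dots> = (\<Sum>k<m. (f k * A) $$ (i,j))"
    by (subst sum.swap) (use assms ij in \<open>auto intro!: sum.cong simp: mult_index_Mn\<close>)
  finally show "(msum n f {..<m} * A) $$ (i,j) = msum n (\<lambda>k. f k * A) {..<m} $$ (i,j)" using ij by (simp add: msum_index)
qed (use assms in auto)

lemma cadj_msum:
  assumes "\<And>k. k < (m::nat) \<Longrightarrow> f k \<in> Mn"
  shows "cadj (msum n f {..<m}) = msum n (\<lambda>k. cadj (f k)) {..<m}"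
  by (rule mat_eqI) (use assms in \<open>auto simp: msum_index cadj_index[of _ n n] intro!: sum.cong\<close>)

lemma mtrace_msum:
  assumes "\<And>k. k < (m::nat) \<Longrightarrow> f k \<in> Mn"
  shows "mtrace (msum n f {..<m}) = (\<Sum>k<m. mtrace (f k))"
proof -
  have "mtrace (msum n f {..<m}) = (\<Sum>i<n. \<Sum>k<m. f k $$ (i,i))"
    by (simp add: mtrace_eq[of _ n n] msum_index)
  also have "\<dots> = (\<Sum>k<m. mtrace (f k))"
    by (subst sum.swap) (auto intro!: sum.cong simp: mtrace_eq[of _ n n] assms)
  finally show ?thesis .
qed

lemma msum_single:
  assumes "j < (m::nat)" "A \<in> Mn"
  shows "msum n (\<lambda>k. if k = j then A else 0\<^sub>m n n) {..<m} = A"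
proof (rule mat_eqI)
  fix a b assume ab: "a < n" "b < n"
  have "(\<Sum>k<m. (if k = j then A else 0\<^sub>m n n) $$ (a,b)) = (\<Sum>k<m. if k = j then A $$ (a,b) else 0)"
    using ab by (intro sum.cong) auto
  then show "msum n (\<lambda>k. if k = j then A else 0\<^sub>m n n) {..<m} $$ (a,b) = A $$ (a,b)"
    using ab assms by (simp add: msum_index)
qed (use assms in auto)

lemma mtrace_add: "A \<in> Mn \<Longrightarrow> B \<in> Mn \<Longrightarrow> mtrace (A + B) = mtrace A + mtrace B"
  by (auto simp: mtrace_eq[of _ n n] sum.distrib)

lemma mtrace_smult: "A \<in> Mn \<Longrightarrow> mtrace (c \<cdot>\<^sub>m A) = c * mtrace A"
  by (auto simp: mtrace_eq[of _ n n] sum_distrib_left)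

lemma cadj_add: "A \<in> Mn \<Longrightarrow> B \<in> Mn \<Longrightarrow> cadj (A + B) = cadj A + cadj B"
  by (rule mat_eqI) (auto simp: cadj_index[of _ n n] simp del: index_add_mat)

lemma cadj_smult: "A \<in> Mn \<Longrightarrow> cadj (c \<cdot>\<^sub>m A) = cnj c \<cdot>\<^sub>m cadj A"
  by (rule mat_eqI) (auto simp: cadj_index[of _ n n] simp del: index_smult_mat)

lemma cadj_mult_self_index:
  assumes "X \<in> Mn" "i < n" "j < n"
  shows "(cadj X * X) $$ (i,j) = (\<Sum>l<n. cnj (X $$ (l,i)) * X $$ (l,j))"
  by (subst mult_index_Mn) (use assms in \<open>auto simp: cadj_index[of _ n n]\<close>)

lemma mtrace_cadj_mult_self:
  assumes "X \<in> Mn"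
  shows "mtrace (cadj X * X) = complex_of_real (\<Sum>i<n. \<Sum>l<n. (cmod (X $$ (l,i)))\<^sup>2)"
proof -
  have "mtrace (cadj X * X) = (\<Sum>i<n. \<Sum>l<n. cnj (X $$ (l,i)) * X $$ (l,i))"
    by (subst mtrace_eq[of _ n n]) (use assms in \<open>auto simp: cadj_mult_self_index\<close>)
  then show ?thesis unfolding of_real_sum complex_norm_square by (simp add: mult.commute)
qed

lemma hs_norm2_eq: "X \<in> Mn \<Longrightarrow> hs_norm2 X = (\<Sum>i<n. \<Sum>l<n. (cmod (X $$ (l,i)))\<^sup>2)"
  unfolding hs_norm2_def mtrace_cadj_mult_self by simp

lemma mtrace_gram: "X \<in> Mn \<Longrightarrow> mtrace (cadj X * X) = complex_of_real (hs_norm2 X)"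
  unfolding hs_norm2_eq by (rule mtrace_cadj_mult_self)

lemma hs_norm2_nonneg [simp]: "X \<in> Mn \<Longrightarrow> hs_norm2 X \<ge> 0"
  unfolding hs_norm2_eq by (intro sum_nonneg) auto

lemma hs_norm2_cadj: "X \<in> Mn \<Longrightarrow> hs_norm2 (cadj X) = hs_norm2 X"
  unfolding hs_norm2_def by (simp add: mtrace_comm_Mn)

lemma hs_norm2_smult:
  assumes "X \<in> Mn" shows "hs_norm2 (complex_of_real c \<cdot>\<^sub>m X) = c\<^sup>2 * hs_norm2 X"
proof -
  have X: "complex_of_real c \<cdot>\<^sub>m X \<in> Mn" using assms by simp
  show ?thesis unfolding hs_norm2_eq[OF X] hs_norm2_eq[OF assms] sum_distrib_left
    using assms by (intro sum.cong refl) (simp add: norm_mult power_mult_distrib)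
qed

text \<open>Polarisation. Together with \<open>hs_norm2_nonneg\<close>, applied to a suitably scaled
  second summand, it takes the place of the Cauchy-Schwarz inequality.\<close>

lemma hs_norm2_add:
  assumes "A \<in> Mn" "B \<in> Mn"
  shows "hs_norm2 (A + B) = hs_norm2 A + hs_norm2 B + 2 * Re (mtrace (cadj A * B))"
proof -
  have c: "cadj A \<in> Mn" "cadj B \<in> Mn" using assms by auto
  have "cadj (A + B) * (A + B) = (cadj A * A + cadj A * B) + (cadj B * A + cadj B * B)"
    using assms c by (simp add: cadj_add add_mult_distrib_mat[of _ n n _ _ n])
      (simp add: mult_add_distrib_mat[of _ n n _ n])
  then have "mtrace (cadj (A + B) * (A + B)) =
      (mtrace (cadj A * A) + mtrace (cadj A * B)) + (mtrace (cadj B * A) + mtrace (cadj B * B))"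
    using assms c by (simp add: mtrace_add)
  moreover have "mtrace (cadj B * A) = cnj (mtrace (cadj A * B))"
    using mtrace_cadj[of "cadj A * B" n] assms c by (simp add: cadj_Mn)
  ultimately show ?thesis unfolding hs_norm2_def by simp
qed

lemma psd_Mn [simp]: "psd n A \<Longrightarrow> A \<in> Mn" and psd_cadj [simp]: "psd n A \<Longrightarrow> cadj A = A"
  unfolding psd_def by auto

text \<open>The quadratic form at v is the squared length of X v. Positivity is mostly obtained
  below by exhibiting a Gram matrix.\<close>

lemma psd_gram:
  assumes X: "X \<in> Mn" shows "psd n (cadj X * X)"
  unfolding psd_def
proof (intro conjI ballI)
  show "cadj X * X \<in> Mn" "cadj (cadj X * X) = cadj X * X" using X by (auto simp: cadj_Mn)
  fix v :: "complex vec" assume v: "v \<in> carrier_vec n"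
  have "conjugate v \<bullet> ((cadj X * X) *\<^sub>v v)
      = (\<Sum>i<n. \<Sum>l<n. \<Sum>k<n. cnj (X $$ (k,i) * v $ i) * (X $$ (k,l) * v $ l))"
    by (subst cscalar_prod_mult_mat_vec)
      (use X v in \<open>auto intro!: sum.cong simp: cadj_mult_self_index sum_distrib_left sum_distrib_right mult_ac\<close>)
  also have "\<dots> = (\<Sum>k<n. \<Sum>i<n. \<Sum>l<n. cnj (X $$ (k,i) * v $ i) * (X $$ (k,l) * v $ l))"
    by (subst (2) sum.swap, subst sum.swap, rule refl)
  also have "\<dots> = (\<Sum>k<n. cnj (\<Sum>i<n. X $$ (k,i) * v $ i) * (\<Sum>l<n. X $$ (k,l) * v $ l))"
    by (simp add: sum_product)
  also have "\<dots> = complex_of_real (\<Sum>k<n. (cmod (\<Sum>l<n. X $$ (k,l) * v $ l))\<^sup>2)"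
    unfolding of_real_sum complex_norm_square by (simp add: mult.commute)
  also have "0 \<le> \<dots>" by (simp add: sum_nonneg less_eq_complex_def)
  finally show "0 \<le> conjugate v \<bullet> ((cadj X * X) *\<^sub>v v)" .
qed

lemma psd_msum:
  assumes "\<And>k. k < (m::nat) \<Longrightarrow> psd n (f k)" shows "psd n (msum n f {..<m})"
  unfolding psd_def
proof (intro conjI ballI)
  show "cadj (msum n f {..<m}) = msum n f {..<m}" using assms by (auto simp: cadj_msum intro!: msum_cong)
  fix v :: "complex vec" assume v: "v \<in> carrier_vec n"
  have "conjugate v \<bullet> (msum n f {..<m} *\<^sub>v v)
      = (\<Sum>i<n. \<Sum>l<n. \<Sum>k<m. f k $$ (i,l) * v $ l * cnj (v $ i))"
    by (subst cscalar_prod_mult_mat_vec) (use v in \<open>auto simp: msum_index sum_distrib_right\<close>)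
  also have "\<dots> = (\<Sum>i<n. \<Sum>k<m. \<Sum>l<n. f k $$ (i,l) * v $ l * cnj (v $ i))"
    by (intro sum.cong refl sum.swap)
  also have "\<dots> = (\<Sum>k<m. \<Sum>i<n. \<Sum>l<n. f k $$ (i,l) * v $ l * cnj (v $ i))"
    by (rule sum.swap)
  also have "\<dots> = (\<Sum>k<m. conjugate v \<bullet> (f k *\<^sub>v v))"
    using assms v by (intro sum.cong refl, subst cscalar_prod_mult_mat_vec) auto
  also have "0 \<le> \<dots>" using assms v unfolding psd_def by (intro sum_nonneg) auto
  finally show "0 \<le> conjugate v \<bullet> (msum n f {..<m} *\<^sub>v v)" .
qed simp

lemma psd_smult:
  assumes "psd n A" "c \<ge> 0" shows "psd n (complex_of_real c \<cdot>\<^sub>m A)"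
  unfolding psd_def
proof (intro conjI ballI)
  show "complex_of_real c \<cdot>\<^sub>m A \<in> Mn" "cadj (complex_of_real c \<cdot>\<^sub>m A) = complex_of_real c \<cdot>\<^sub>m A"
    using assms by (auto simp: cadj_smult)
  fix v :: "complex vec" assume v: "v \<in> carrier_vec n"
  have "conjugate v \<bullet> ((complex_of_real c \<cdot>\<^sub>m A) *\<^sub>v v) = complex_of_real c * (conjugate v \<bullet> (A *\<^sub>v v))"
    using assms v by (subst (1 2) cscalar_prod_mult_mat_vec)
      (auto simp: sum_distrib_left mult_ac simp del: index_smult_mat)
  moreover have "0 \<le> conjugate v \<bullet> (A *\<^sub>v v)" using assms v unfolding psd_def by auto
  ultimately show "0 \<le> conjugate v \<bullet> ((complex_of_real c \<cdot>\<^sub>m A) *\<^sub>v v)"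
    using assms(2) by (simp add: less_eq_complex_def)
qed

lemma unitaryD:
  assumes "unitary_mat n U"
  shows "U \<in> Mn" "cadj U \<in> Mn" "cadj U * U = 1\<^sub>m n" "U * cadj U = 1\<^sub>m n"
    "X \<in> Mn \<Longrightarrow> cadj U * (U * X) = X" "X \<in> Mn \<Longrightarrow> U * (cadj U * X) = X"
  using assms by (auto simp: unitary_mat_def assoc_Mn[symmetric])

lemma hs_norm2_unitary:
  assumes U: "unitary_mat n U" and X: "X \<in> Mn" shows "hs_norm2 (U * X) = hs_norm2 X"
  using X unitaryD[OF U] by (simp add: hs_norm2_def cadj_Mn assoc_Mn)

lemma unitary_of_orthonormal:
  assumes v: "\<And>j. j < n \<Longrightarrow> v j \<in> carrier_vec n"
    and on: "\<And>j k. j < n \<Longrightarrow> k < n \<Longrightarrow> v j \<bullet>c v k = (if j = k then 1 else 0)"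
  shows "unitary_mat n (mat n n (\<lambda>(i,j). v j $ i))"
proof -
  define V where "V = mat n n (\<lambda>(i,j). v j $ i)"
  have V: "V \<in> Mn" by (simp add: V_def)
  have 1: "cadj V * V = 1\<^sub>m n"
  proof (rule mat_eqI)
    fix i j assume ij: "i < n" "j < n"
    have "(cadj V * V) $$ (i,j) = (\<Sum>l<n. v j $ l * cnj (v i $ l))"
      using ij by (simp add: cadj_mult_self_index[OF V], simp add: V_def mult.commute)
    also have "\<dots> = v j \<bullet>c v i" using cscalar_prod_sum[OF v[OF ij(1)]] by simp
    finally show "(cadj V * V) $$ (i,j) = 1\<^sub>m n $$ (i,j)" using on ij by auto
  qed (use V in auto)
  have "V * cadj V = 1\<^sub>m n" by (rule mat_mult_left_right_inverse[OF _ V 1]) (use V in auto)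
  with 1 V show ?thesis unfolding unitary_mat_def V_def by auto
qed

subsection \<open>Positive square roots and polar decomposition\<close>

lemma real_diag_Mn [simp]: "real_diag n d \<in> Mn"
  by (simp add: real_diag_def)

lemma real_diag_mult_index:
  assumes "X \<in> Mn" "i < n" "j < n"
  shows "(real_diag n d * X) $$ (i,j) = d i * X $$ (i,j)"
    and "(X * real_diag n d) $$ (i,j) = d j * X $$ (i,j)"
proof -
  have "(real_diag n d * X) $$ (i,j) = (\<Sum>l<n. real_diag n d $$ (i,l) * X $$ (l,j))"
    using assms by (intro mult_index_Mn) auto
  also have "\<dots> = (\<Sum>l<n. if l = i then d i * X $$ (i,j) else 0)"
    using assms by (intro sum.cong) (auto simp: real_diag_def)
  finally show "(real_diag n d * X) $$ (i,j) = d i * X $$ (i,j)" using assms by simp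
  have "(X * real_diag n d) $$ (i,j) = (\<Sum>l<n. X $$ (i,l) * real_diag n d $$ (l,j))"
    using assms by (intro mult_index_Mn) auto
  also have "\<dots> = (\<Sum>l<n. if l = j then d j * X $$ (i,j) else 0)"
    using assms by (intro sum.cong) (auto simp: real_diag_def)
  finally show "(X * real_diag n d) $$ (i,j) = d j * X $$ (i,j)" using assms by simp
qed

lemma cadj_real_diag [simp]: "cadj (real_diag n d) = real_diag n d"
  by (rule mat_eqI) (auto simp: cadj_index[of _ n n], auto simp: real_diag_def)

lemma real_diag_mult: "real_diag n d * real_diag n e = real_diag n (\<lambda>i. d i * e i)"
  by (rule mat_eqI) (auto simp: real_diag_mult_index, auto simp: real_diag_def)

lemma real_diag_cong: "(\<And>i. i < n \<Longrightarrow> d i = e i) \<Longrightarrow> real_diag n d = real_diag n e"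
  unfolding real_diag_def by (intro cong_mat) auto

lemma psd_real_diag:
  assumes V: "V \<in> Mn" and d: "\<And>i. i < n \<Longrightarrow> d i \<ge> 0"
  shows "psd n (V * (real_diag n d * cadj V))"
proof -
  have "V * (real_diag n d * cadj V)
      = cadj (real_diag n (\<lambda>i. sqrt (d i)) * cadj V) * (real_diag n (\<lambda>i. sqrt (d i)) * cadj V)"
  proof -
    have "real_diag n d = real_diag n (\<lambda>i. sqrt (d i)) * real_diag n (\<lambda>i. sqrt (d i))"
      unfolding real_diag_mult by (rule real_diag_cong) (simp add: d)
    then show ?thesis using V by (simp add: cadj_Mn assoc_Mn)
  qed
  then show ?thesis using psd_gram[of "real_diag n (\<lambda>i. sqrt (d i)) * cadj V"] V by simp
qed

text \<open>An empty family of eigenvectors is completed to a basis; the quadratic form at an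
  eigenvector shows that its eigenvalue is nonnegative.\<close>

lemma psd_spectral:
  assumes A: "psd n A"
  obtains V d where "unitary_mat n V" "\<And>i. i < n \<Longrightarrow> d i \<ge> 0" "A = V * (real_diag n d * cadj V)"
proof -
  have "orthonormal_eigenvectors n A {} (\<lambda>_. 0\<^sub>v n) (\<lambda>_. 0)"
    unfolding orthonormal_eigenvectors_def by simp
  from extend_orthonormal_eigenvectors[OF psd_Mn[OF A] psd_cadj[OF A] _ this]
  obtain v d where "orthonormal_eigenvectors n A {..<n} v d" by blast
  then have v: "\<And>j. j < n \<Longrightarrow> v j \<in> carrier_vec n"
    and Av: "\<And>j. j < n \<Longrightarrow> A *\<^sub>v v j = complex_of_real (d j) \<cdot>\<^sub>v v j"
    and on: "\<And>j k. j < n \<Longrightarrow> k < n \<Longrightarrow> v j \<bullet>c v k = (if j = k then 1 else 0)"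
    unfolding orthonormal_eigenvectors_def by auto
  define V where "V = mat n n (\<lambda>(i,j). v j $ i)"
  have V: "unitary_mat n V" unfolding V_def by (rule unitary_of_orthonormal[OF v on])
  note VD = unitaryD[OF V]
  have "A * V = V * real_diag n d"
  proof (rule mat_eqI)
    fix i j assume ij: "i < n" "j < n"
    have "(A * V) $$ (i,j) = (A *\<^sub>v v j) $ i"
      using A ij VD(1) v[OF ij(2)]
      by (subst mult_index_Mn, auto simp: mult_vec_index[of _ n n] simp del: index_mult_mat_vec)
        (auto simp: V_def)
    also have "\<dots> = d j * V $$ (i,j)" unfolding Av[OF ij(2)] using ij v[OF ij(2)] by (simp add: V_def)
    finally show "(A * V) $$ (i,j) = (V * real_diag n d) $$ (i,j)"
      using ij VD by (simp add: real_diag_mult_index)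
  qed (use A VD in auto)
  then have "A * V * cadj V = V * (real_diag n d * cadj V)" using VD by (simp add: assoc_Mn)
  then have eq: "A = V * (real_diag n d * cadj V)" using VD A by (simp add: assoc_Mn)
  have d: "d j \<ge> 0" if j: "j < n" for j
  proof -
    have "0 \<le> conjugate (v j) \<bullet> (A *\<^sub>v v j)" using A v[OF j] unfolding psd_def by auto
    also have "\<dots> = d j * (v j \<bullet>c v j)"
      unfolding Av[OF j] using v[OF j]
      by (subst conjugate_scalar_prod_eq[of _ n]) (auto)
    also have "\<dots> = d j" using on[OF j j] by simp
    finally show ?thesis by (simp add: less_eq_complex_def)
  qed
  show ?thesis by (rule that[OF V d eq])
qed

text \<open>In eigenbases of A and B the hypothesis reads
  a^2 y = y b^2 for every entry y of X, so a y = y b because a and b are nonnegative.\<close>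
lemma psd_square_intertwine:
  assumes A: "psd n A" and B: "psd n B" and X: "X \<in> Mn" and eq: "(A * A) * X = X * (B * B)"
  shows "A * X = X * B"
proof -
  obtain V a where V: "unitary_mat n V" and a: "\<And>i. i < n \<Longrightarrow> a i \<ge> 0"
    and Aeq: "A = V * (real_diag n a * cadj V)" using psd_spectral[OF A] by metis
  obtain W b where W: "unitary_mat n W" and b: "\<And>i. i < n \<Longrightarrow> b i \<ge> 0"
    and Beq: "B = W * (real_diag n b * cadj W)" using psd_spectral[OF B] by metis
  note VD = unitaryD[OF V] and WD = unitaryD[OF W]
  define Y where "Y = cadj V * (X * W)"
  have Y: "Y \<in> Mn" using VD WD X by (simp add: Y_def)
  have "cadj V * (((A * A) * X) * W) = real_diag n a * (real_diag n a * Y)"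
    unfolding Aeq Y_def using VD WD X by (simp add: assoc_Mn)
  moreover have "cadj V * ((X * (B * B)) * W) = (Y * real_diag n b) * real_diag n b"
    unfolding Beq Y_def using VD WD X by (simp add: assoc_Mn)
  ultimately have sq: "real_diag n a * (real_diag n a * Y) = (Y * real_diag n b) * real_diag n b"
    using eq by simp
  have comm: "real_diag n a * Y = Y * real_diag n b"
  proof (rule mat_eqI)
    fix i j assume ij: "i < n" "j < n"
    have "complex_of_real (a i) * (a i * Y $$ (i,j)) = b j * (b j * Y $$ (i,j))"
      using arg_cong[OF sq, of "\<lambda>M. M $$ (i,j)"] ij Y by (simp add: real_diag_mult_index)
    then have "complex_of_real ((a i)\<^sup>2 - (b j)\<^sup>2) * Y $$ (i,j) = 0"
      by (simp add: power2_eq_square algebra_simps)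
    then have "Y $$ (i,j) = 0 \<or> (a i)\<^sup>2 = (b j)\<^sup>2" by (auto simp flip: of_real_power)
    then have "Y $$ (i,j) = 0 \<or> a i = b j" using a[OF ij(1)] b[OF ij(2)] by (auto simp: power2_eq_iff_nonneg)
    then show "(real_diag n a * Y) $$ (i,j) = (Y * real_diag n b) $$ (i,j)"
      using ij Y by (auto simp: real_diag_mult_index)
  qed (use Y in auto)
  have "A * X = V * ((real_diag n a * Y) * cadj W)"
    unfolding Aeq Y_def using VD WD X by (simp add: assoc_Mn)
  also have "\<dots> = X * B" unfolding comm unfolding Beq Y_def using VD WD X by (simp add: assoc_Mn)
  finally show ?thesis .
qed

text \<open>Uniqueness of the positive root is \<open>psd_square_intertwine\<close> with the
  identity as intertwiner; it allows the definite description in \<open>msqrt\<close> to be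
  evaluated.\<close>

lemma msqrt_eqI:
  assumes B: "psd n B" and BA: "B * B = A" shows "msqrt n A = B"
  unfolding msqrt_def
proof (rule the_equality)
  fix C assume C: "psd n C \<and> C * C = A"
  have "C * 1\<^sub>m n = 1\<^sub>m n * B"
    by (rule psd_square_intertwine) (use B C BA in auto)
  then show "C = B" using B C by simp
qed (use assms in auto)

lemma msqrt_psd:
  assumes A: "psd n A" shows "psd n (msqrt n A)" "msqrt n A * msqrt n A = A"
proof -
  obtain V a where V: "unitary_mat n V" and a: "\<And>i. i < n \<Longrightarrow> a i \<ge> 0"
    and Aeq: "A = V * (real_diag n a * cadj V)" using psd_spectral[OF A] by metis
  note VD = unitaryD[OF V]
  define B where "B = V * (real_diag n (\<lambda>i. sqrt (a i)) * cadj V)"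
  have B: "psd n B" unfolding B_def by (rule psd_real_diag) (use VD a in auto)
  have "real_diag n a = real_diag n (\<lambda>i. sqrt (a i)) * real_diag n (\<lambda>i. sqrt (a i))"
    unfolding real_diag_mult by (rule real_diag_cong) (simp add: a)
  then have "B * B = A" unfolding Aeq B_def using VD by (simp add: assoc_Mn)
  with B show "psd n (msqrt n A)" "msqrt n A * msqrt n A = A" using msqrt_eqI[OF B] by auto
qed

text \<open>If V diagonalises the Gram matrix of Z, the columns of Z V are orthogonal with squared
  lengths d_j. Normalised and completed to a basis W, they give Z = W D \<open>cadj V\<close>, a
  singular value decomposition, and V \<open>cadj W\<close> turns Z into V D
  \<open>cadj V\<close>.\<close>

lemma polar_unitary:
  assumes Z: "Z \<in> Mn"
  obtains U where "unitary_mat n U" "psd n (U * Z)"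
proof -
  obtain V d where V: "unitary_mat n V" and d: "\<And>i. i < n \<Longrightarrow> d i \<ge> 0"
    and eq: "cadj Z * Z = V * (real_diag n d * cadj V)" using psd_spectral[OF psd_gram[OF Z]] by metis
  note VD = unitaryD[OF V]
  define X where "X = Z * V"
  have X: "X \<in> Mn" using Z VD by (simp add: X_def)
  have "cadj X * X = cadj V * ((cadj Z * Z) * V)"
    unfolding X_def using Z VD by (simp add: cadj_Mn assoc_Mn)
  also have "\<dots> = real_diag n d" unfolding eq using VD by (simp add: assoc_Mn)
  finally have gram: "cadj X * X = real_diag n d" .
  have X_on: "(\<Sum>l<n. X $$ (l,k) * cnj (X $$ (l,j))) = (if j = k then complex_of_real (d j) else 0)"
    if "j < n" "k < n" for j k
    using arg_cong[OF gram, of "\<lambda>M. M $$ (j,k)"] that cadj_mult_self_index[OF X that]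
    by (simp add: real_diag_def mult.commute)
  \<comment> \<open>Columns of length zero cannot be normalised. Their places are left to arbitrary
    completing vectors, which D multiplies by 0.\<close>
  define J where "J = {j. j < n \<and> d j > 0}"
  define w where "w = (\<lambda>j. vec n (\<lambda>i. X $$ (i,j) / complex_of_real (sqrt (d j))))"
  have "orthonormal_eigenvectors n (0\<^sub>m n n) J w (\<lambda>_. 0)"
    unfolding orthonormal_eigenvectors_def
  proof (intro conjI ballI)
    show "w j \<in> carrier_vec n" for j by (simp add: w_def)
    show "0\<^sub>m n n *\<^sub>v w j = complex_of_real 0 \<cdot>\<^sub>v w j" for j by (rule eq_vecI) (auto simp: w_def)
    fix j k assume jk: "j \<in> J" "k \<in> J"
    have "w j \<bullet>c w k = (\<Sum>l<n. X $$ (l,j) * cnj (X $$ (l,k)))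
        / (complex_of_real (sqrt (d j)) * complex_of_real (sqrt (d k)))"
      by (subst cscalar_prod_sum[of _ n]) (auto simp: w_def sum_divide_distrib intro!: sum.cong)
    also have "\<dots> = (if j = k then 1 else 0)"
      using jk by (subst X_on) (auto simp: J_def simp flip: of_real_mult)
    finally show "w j \<bullet>c w k = (if j = k then 1 else 0)" .
  qed
  moreover have "cadj (0\<^sub>m n n) = 0\<^sub>m n n" by (rule mat_eqI) (auto simp: cadj_index[of _ n n])
  moreover have "J \<subseteq> {..<n}" by (auto simp: J_def)
  ultimately obtain w' d' where ev: "orthonormal_eigenvectors n (0\<^sub>m n n) {..<n} w' d'"
    and w': "\<And>j. j \<in> J \<Longrightarrow> w' j = w j"
    using extend_orthonormal_eigenvectors[of "0\<^sub>m n n" n J w "\<lambda>_. 0"] by auto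
  define W where "W = mat n n (\<lambda>(i,j). w' j $ i)"
  have W: "unitary_mat n W" unfolding W_def
    by (rule unitary_of_orthonormal) (use ev in \<open>auto simp: orthonormal_eigenvectors_def\<close>)
  note WD = unitaryD[OF W]
  define D where "D = real_diag n (\<lambda>i. sqrt (d i))"
  have "X = W * D"
  proof (rule mat_eqI)
    fix i j assume ij: "i < n" "j < n"
    have rhs: "(W * D) $$ (i,j) = sqrt (d j) * w' j $ i"
      unfolding D_def using real_diag_mult_index(2)[OF WD(1) ij] ij by (simp add: W_def)
    show "X $$ (i,j) = (W * D) $$ (i,j)"
    proof (cases "d j > 0")
      case True
      then show ?thesis unfolding rhs using ij w' by (simp add: J_def w_def)
    next
      case False
      then have dj: "d j = 0" using d[OF ij(2)] by simp
      have "complex_of_real (\<Sum>l<n. (cmod (X $$ (l,j)))\<^sup>2) = 0"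
        unfolding of_real_sum complex_norm_square using X_on[OF ij(2) ij(2)] dj by simp
      then have "(\<Sum>l<n. (cmod (X $$ (l,j)))\<^sup>2) = 0" by (simp only: of_real_eq_0_iff)
      then have "X $$ (i,j) = 0" using ij by (simp add: sum_nonneg_eq_0_iff)
      then show ?thesis unfolding rhs dj by simp
    qed
  qed (use X WD in \<open>auto simp: D_def\<close>)
  then have Z_eq: "Z = W * (D * cadj V)"
    using Z VD WD unfolding X_def
    by (metis D_def assoc_Mn real_diag_Mn right_mult_one_mat)
  have U: "unitary_mat n (V * cadj W)"
    unfolding unitary_mat_def using VD WD by (simp add: cadj_Mn assoc_Mn)
  have "(V * cadj W) * Z = V * (D * cadj V)"
    unfolding Z_eq using VD WD by (simp add: D_def assoc_Mn)
  then have "psd n ((V * cadj W) * Z)"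
    unfolding D_def using psd_real_diag[of V "\<lambda>i. sqrt (d i)"] VD d by simp
  with U show ?thesis by (rule that)
qed

subsection \<open>Fidelity\<close>

text \<open>The square of the positive matrix U Z, with Z the product of the two roots, is the Gram
  matrix of Z. So U Z is the very root whose trace defines the fidelity.\<close>

lemma fidelity_polar:
  assumes \<rho>: "psd n \<rho>" and \<sigma>: "psd n \<sigma>" and U: "unitary_mat n U"
    and pos: "psd n (U * (msqrt n \<rho> * msqrt n \<sigma>))"
  shows "fidelity n \<rho> \<sigma> = Re (mtrace (U * (msqrt n \<rho> * msqrt n \<sigma>)))"
proof -
  note R = msqrt_psd[OF \<rho>] and T = msqrt_psd[OF \<sigma>] and UD = unitaryD[OF U]
  define Z where "Z = msqrt n \<rho> * msqrt n \<sigma>"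
  have Z: "Z \<in> Mn" using R T by (simp add: Z_def)
  have "(U * Z) * (U * Z) = cadj (U * Z) * (U * Z)" using pos by (simp add: Z_def)
  also have "\<dots> = cadj Z * Z" using Z UD by (simp add: cadj_Mn assoc_Mn)
  also have "\<dots> = msqrt n \<sigma> * (msqrt n \<rho> * msqrt n \<rho>) * msqrt n \<sigma>"
    unfolding Z_def using R(1) T(1) by (simp add: cadj_Mn assoc_Mn)
  finally have "(U * Z) * (U * Z) = msqrt n \<sigma> * \<rho> * msqrt n \<sigma>" unfolding R(2) .
  then have "msqrt n (msqrt n \<sigma> * \<rho> * msqrt n \<sigma>) = U * Z"
    using pos by (intro msqrt_eqI) (auto simp: Z_def)
  then show ?thesis unfolding fidelity_def Z_def by simp
qed

text \<open>One half of the duality between trace norm and operator norm. With U Z = S S and X = C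
  \<open>cadj U\<close> S, the trace of C Z equals that of S X; X is no longer than S, and the
  squared norm of S is the fidelity. Contractions are described by Hilbert-Schmidt norms because
  that is how a POVM supplies them.\<close>

lemma contraction_le_fidelity:
  assumes \<rho>: "psd n \<rho>" and \<sigma>: "psd n \<sigma>" and C: "C \<in> Mn"
    and contr: "\<And>Y. Y \<in> Mn \<Longrightarrow> hs_norm2 (C * Y) \<le> hs_norm2 Y"
  shows "Re (mtrace (C * (msqrt n \<rho> * msqrt n \<sigma>))) \<le> fidelity n \<rho> \<sigma>"
proof -
  note R = msqrt_psd[OF \<rho>] and T = msqrt_psd[OF \<sigma>]
  define Z where "Z = msqrt n \<rho> * msqrt n \<sigma>"
  have Z: "Z \<in> Mn" using R T by (simp add: Z_def)
  obtain U where U: "unitary_mat n U" and pos: "psd n (U * Z)" using polar_unitary[OF Z] by metis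
  note UD = unitaryD[OF U]
  define S where "S = msqrt n (U * Z)"
  have S: "psd n S" "S * S = U * Z" using msqrt_psd[OF pos] by (auto simp: S_def)
  have SM: "S \<in> Mn" "cadj S = S" using S by auto
  define X where "X = C * (cadj U * S)"
  have X: "X \<in> Mn" using C UD SM by (simp add: X_def)
  have F: "hs_norm2 S = fidelity n \<rho> \<sigma>"
    unfolding hs_norm2_def using fidelity_polar[OF \<rho> \<sigma> U] pos S by (simp add: Z_def)
  have "mtrace (S * X) = mtrace (X * S)" using X SM by (intro mtrace_comm_Mn)
  also have "X * S = C * (cadj U * (S * S))" using C UD SM by (simp add: X_def assoc_Mn)
  also have "\<dots> = C * Z" unfolding S(2) using UD Z by simp
  finally have tr: "mtrace (S * X) = mtrace (C * Z)" .
  have "hs_norm2 X \<le> hs_norm2 (cadj U * S)" unfolding X_def using UD SM by (intro contr) auto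
  also have "\<dots> = hs_norm2 S"
    using hs_norm2_unitary[of "cadj U" S] UD SM by (simp add: unitary_mat_def)
  finally have le: "hs_norm2 X \<le> hs_norm2 S" .
  \<comment> \<open>Expanding the norm of S - X bounds 2 Re Tr (S X) by the sum of the squared norms
    of S and X.\<close>
  define X' where "X' = complex_of_real (-1) \<cdot>\<^sub>m X"
  have X': "X' \<in> Mn" using X by (simp add: X'_def)
  have "S * X' = complex_of_real (-1) \<cdot>\<^sub>m (S * X)" unfolding X'_def by (rule mult_smult_distrib[OF SM(1) X])
  then have "mtrace (S * X') = - mtrace (C * Z)" using mtrace_smult[of "S * X"] SM X tr by simp
  moreover have "hs_norm2 X' = hs_norm2 X" unfolding X'_def hs_norm2_smult[OF X] by simp
  moreover have "0 \<le> hs_norm2 (S + X')" using SM X' by (intro hs_norm2_nonneg) simp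
  ultimately have "0 \<le> hs_norm2 S + hs_norm2 X - 2 * Re (mtrace (C * Z))"
    using hs_norm2_add[OF SM(1) X'] SM by simp
  then show ?thesis using le F by (simp add: Z_def)
qed

text \<open>Idempotence doubles P and cyclicity moves one copy to the front. This is how success
  terms become squared norms.\<close>

lemma trace_gram_conj_proj:
  assumes "L \<in> Mn" "R \<in> Mn" "cadj R = R" "P \<in> Mn" "cadj P = P" "P * P = P"
  shows "Re (mtrace ((cadj L * L) * (R * P * R))) = hs_norm2 (L * (R * P))"
proof -
  have PPR: "P * (P * R) = P * R" using assms by (simp add: assoc_Mn[symmetric])
  have "(cadj L * L) * (R * P * R) = (cadj L * (L * (R * P))) * (P * R)"
    using assms PPR by (simp add: assoc_Mn)
  then have "mtrace ((cadj L * L) * (R * P * R)) = mtrace ((P * R) * (cadj L * (L * (R * P))))"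
    using assms mtrace_comm_Mn[of "cadj L * (L * (R * P))" "P * R"] by simp
  also have "(P * R) * (cadj L * (L * (R * P))) = cadj (L * (R * P)) * (L * (R * P))"
    using assms by (simp add: cadj_Mn assoc_Mn)
  finally show ?thesis unfolding hs_norm2_def by simp
qed

text \<open>Since the M_i add up to the identity, the roots of the M_i stacked above each other form
  an isometry, as in the Naimark dilation.\<close>

lemma sum_hs_norm2_povm:
  assumes M: "povm n m M" and Y: "Y \<in> Mn"
  shows "(\<Sum>i<m. hs_norm2 (msqrt n (M i) * Y)) = hs_norm2 Y"
proof -
  have psd: "psd n (M i)" if "i < m" for i using M that by (simp add: povm_def)
  have "hs_norm2 (msqrt n (M i) * Y) = Re (mtrace ((cadj Y * M i) * Y))" if i: "i < m" for i
  proof -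
    note L = msqrt_psd[OF psd[OF i]]
    have "cadj (msqrt n (M i) * Y) * (msqrt n (M i) * Y) = (cadj Y * (msqrt n (M i) * msqrt n (M i))) * Y"
      using L(1) Y by (simp add: cadj_Mn assoc_Mn)
    then show ?thesis unfolding L(2) hs_norm2_def by simp
  qed
  then have "(\<Sum>i<m. hs_norm2 (msqrt n (M i) * Y)) = Re (\<Sum>i<m. mtrace ((cadj Y * M i) * Y))" by simp
  also have "(\<Sum>i<m. mtrace ((cadj Y * M i) * Y)) = mtrace (msum n (\<lambda>i. (cadj Y * M i) * Y) {..<m})"
    using psd Y by (subst mtrace_msum) auto
  also have "msum n (\<lambda>i. (cadj Y * M i) * Y) {..<m} = (cadj Y * msum n M {..<m}) * Y"
    using psd Y by (subst mult_msum) (auto simp: msum_mult)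
  also have "\<dots> = cadj Y * Y" using M Y by (simp add: povm_def)
  finally show ?thesis unfolding hs_norm2_def .
qed

end

subsection \<open>Projective measurements and incoherent states\<close>

text \<open>An abstraction of the Lueders projectors to any von Neumann measurement; the tensor
  structure enters only through \<open>lproj_vn\<close>.\<close>

locale projective_measurement = square_matrices +
  fixes m :: nat and P :: "nat \<Rightarrow> complex mat"
  assumes vn: "vn_measurement n m P"
begin

lemma P_simps [simp]:
  "i < m \<Longrightarrow> P i \<in> Mn" "i < m \<Longrightarrow> cadj (P i) = P i" "i < m \<Longrightarrow> P i * P i = P i"
  using vn by (auto simp: vn_measurement_def)

lemma P_mult: "i < m \<Longrightarrow> j < m \<Longrightarrow> P i * P j = (if j = i then P i else 0\<^sub>m n n)"
  using vn by (auto simp: vn_measurement_def)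

lemma P_mult_left: "i < m \<Longrightarrow> j < m \<Longrightarrow> X \<in> Mn \<Longrightarrow> P i * (P j * X) = (if j = i then P i * X else 0\<^sub>m n n)"
  by (simp add: assoc_Mn[symmetric] P_mult)

lemma msum_P: "msum n P {..<m} = 1\<^sub>m n"
  using vn by (auto simp: vn_measurement_def)

text \<open>Mutual orthogonality removes every term but one, so P_j extracts block j of a block
  sum.\<close>

lemma proj_mult_msum:
  assumes "j < m" and X: "\<And>i. i < m \<Longrightarrow> X i \<in> Mn"
  shows "P j * msum n (\<lambda>i. P i * X i) {..<m} = P j * X j"
proof -
  have "P j * msum n (\<lambda>i. P i * X i) {..<m} = msum n (\<lambda>i. if i = j then P j * X j else 0\<^sub>m n n) {..<m}"
    using assms by (subst mult_msum) (auto simp: P_mult_left intro!: msum_cong)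
  also have "\<dots> = P j * X j" by (rule msum_single) (use assms in auto)
  finally show ?thesis .
qed

lemma msum_mult_proj:
  assumes "j < m" and X: "\<And>i. i < m \<Longrightarrow> X i \<in> Mn"
  shows "msum n (\<lambda>i. X i * P i) {..<m} * P j = X j * P j"
proof -
  have "msum n (\<lambda>i. X i * P i) {..<m} * P j = msum n (\<lambda>i. if i = j then X j * P j else 0\<^sub>m n n) {..<m}"
    using assms by (subst msum_mult) (auto simp: assoc_Mn P_mult intro!: msum_cong)
  also have "\<dots> = X j * P j" by (rule msum_single) (use assms in auto)
  finally show ?thesis .
qed

text \<open>Pythagoras: the summands have mutually orthogonal ranges, so the cross terms of the Gram
  matrix vanish.\<close>

lemma hs_norm2_msum_proj:
  assumes X: "\<And>i. i < m \<Longrightarrow> X i \<in> Mn"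
  shows "hs_norm2 (msum n (\<lambda>i. P i * X i) {..<m}) = (\<Sum>i<m. hs_norm2 (P i * X i))"
proof -
  let ?S = "msum n (\<lambda>i. P i * X i) {..<m}"
  have "cadj ?S * ?S = msum n (\<lambda>i. cadj (P i * X i) * ?S) {..<m}"
    using X by (subst cadj_msum) (auto simp: msum_mult)
  also have "\<dots> = msum n (\<lambda>i. cadj (P i * X i) * (P i * X i)) {..<m}"
    using X by (intro msum_cong) (simp add: cadj_Mn assoc_Mn proj_mult_msum P_mult_left)
  finally have "mtrace (cadj ?S * ?S) = (\<Sum>i<m. mtrace (cadj (P i * X i) * (P i * X i)))"
    using X by (simp add: mtrace_msum)
  then show ?thesis unfolding hs_norm2_def by simp
qed

lemma sum_hs_norm2_proj:
  assumes X: "X \<in> Mn" shows "(\<Sum>i<m. hs_norm2 (P i * X)) = hs_norm2 X"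
proof -
  have "msum n (\<lambda>i. P i * X) {..<m} = X" using X by (subst msum_mult[symmetric]) (auto simp: msum_P)
  then show ?thesis using hs_norm2_msum_proj[of "\<lambda>_. X"] X by simp
qed

lemma hs_norm2_proj_le:
  assumes "X \<in> Mn" "i < m" shows "hs_norm2 (P i * X) \<le> hs_norm2 X"
  unfolding sum_hs_norm2_proj[OF assms(1), symmetric]
  by (rule member_le_sum) (use assms in auto)

lemma povm_of_vn: "povm n m P"
proof -
  have "psd n (P i)" if "i < m" for i using psd_gram[of "P i"] that by simp
  then show ?thesis using msum_P by (simp add: povm_def)
qed

lemma conjugated_vn:
  assumes "unitary_mat n U" shows "vn_measurement n m (\<lambda>i. cadj U * (P i * U))"
proof -
  note UD = unitaryD[OF assms]
  have "msum n (\<lambda>i. cadj U * (P i * U)) {..<m} = cadj U * (msum n P {..<m} * U)"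
    using UD by (subst msum_mult) (auto simp: mult_msum)
  then have "msum n (\<lambda>i. cadj U * (P i * U)) {..<m} = 1\<^sub>m n" using UD by (simp add: msum_P)
  then show ?thesis
    unfolding vn_measurement_def using UD by (auto simp: cadj_Mn assoc_Mn P_mult_left)
qed

section \<open>Incoherent states, scores and the two bounds on the fidelity\<close>

definition incoherent :: "complex mat \<Rightarrow> bool" where
  "incoherent \<sigma> \<longleftrightarrow> density n \<sigma> \<and> msum n (\<lambda>i. P i * \<sigma> * P i) {..<m} = \<sigma>"

text \<open>Since eta_i omega_i = sqrt rho P_i sqrt rho also when eta_i = 0, this is the success
  probability of the ensemble without the division by eta_i.\<close>
definition score :: "complex mat \<Rightarrow> (nat \<Rightarrow> complex mat) \<Rightarrow> real" where
  "score \<rho> M = (\<Sum>i<m. Re (mtrace (M i * (msqrt n \<rho> * P i * msqrt n \<rho>))))"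

lemma trace_povm_element:
  assumes \<rho>: "psd n \<rho>" and M: "psd n M" and i: "i < m"
  shows "Re (mtrace (M * (msqrt n \<rho> * P i * msqrt n \<rho>))) = hs_norm2 (msqrt n M * (msqrt n \<rho> * P i))"
  using trace_gram_conj_proj[of "msqrt n M" "msqrt n \<rho>" "P i"] msqrt_psd[OF \<rho>] msqrt_psd[OF M] i by simp

lemma score_povm:
  assumes \<rho>: "psd n \<rho>" and M: "povm n m M"
  shows "score \<rho> M = (\<Sum>i<m. hs_norm2 (msqrt n (M i) * (msqrt n \<rho> * P i)))"
  unfolding score_def using M trace_povm_element[OF \<rho>] by (auto simp: povm_def intro!: sum.cong)

lemma hs_norm2_msqrt: "psd n \<rho> \<Longrightarrow> hs_norm2 (msqrt n \<rho>) = Re (mtrace \<rho>)"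
  using msqrt_psd[of \<rho>] by (simp add: hs_norm2_def)

lemma hs_norm2_mult_proj:
  assumes "psd n R" "i < m" shows "hs_norm2 (R * P i) = hs_norm2 (P i * R)"
  using hs_norm2_cadj[of "R * P i"] assms by (simp add: cadj_Mn)

lemma povm_element_hs_le:
  assumes M: "povm n m M" and Y: "Y \<in> Mn" and i: "i < m"
  shows "hs_norm2 (msqrt n (M i) * Y) \<le> hs_norm2 Y"
  unfolding sum_hs_norm2_povm[OF M Y, symmetric]
  by (rule member_le_sum) (use M Y i msqrt_psd(1) in \<open>auto simp: povm_def\<close>)

text \<open>Supplies the boundedness that a real \<open>Sup\<close> requires. Without the
  contracting factors sqrt M_i the terms add up to the squared norm of sqrt \<rho>, which is the
  trace of \<rho>.\<close>

lemma score_le_one: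
  assumes \<rho>: "density n \<rho>" and M: "povm n m M" shows "score \<rho> M \<le> 1"
proof -
  have psd: "psd n \<rho>" using \<rho> by (simp add: density_def)
  note R = msqrt_psd[OF psd]
  have "score \<rho> M \<le> (\<Sum>i<m. hs_norm2 (msqrt n \<rho> * P i))"
    unfolding score_povm[OF psd M] using R by (intro sum_mono povm_element_hs_le[OF M]) auto
  also have "\<dots> = (\<Sum>i<m. hs_norm2 (P i * msqrt n \<rho>))" using R by (simp add: hs_norm2_mult_proj)
  also have "\<dots> = 1" using sum_hs_norm2_proj[of "msqrt n \<rho>"] R \<rho> psd
    by (simp add: hs_norm2_msqrt density_def)
  finally show ?thesis .
qed

text \<open>Dephasing removes the off-diagonal blocks, so \<sigma> commutes with P_k; the positive
  root inherits this by \<open>psd_square_intertwine\<close>.\<close>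

lemma incoherent_msqrt_commute:
  assumes \<sigma>: "incoherent \<sigma>" and k: "k < m"
  shows "msqrt n \<sigma> * P k = P k * msqrt n \<sigma>"
proof -
  have psd: "psd n \<sigma>" using \<sigma> by (simp add: incoherent_def density_def)
  note T = msqrt_psd[OF psd]
  \<comment> \<open>The fixed-point equation is bracketed in two ways, to suit block extraction from
    the left and from the right.\<close>
  have sum: "msum n (\<lambda>i. P i * (\<sigma> * P i)) {..<m} = \<sigma>" "msum n (\<lambda>i. (P i * \<sigma>) * P i) {..<m} = \<sigma>"
    using \<sigma> psd_Mn[OF psd] by (auto simp: incoherent_def assoc_Mn cong: msum_cong)
  have "P k * \<sigma> = P k * (\<sigma> * P k)"
    using proj_mult_msum[OF k, of "\<lambda>i. \<sigma> * P i"] psd unfolding sum by simp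
  moreover have "\<sigma> * P k = (P k * \<sigma>) * P k"
    using msum_mult_proj[OF k, of "\<lambda>i. P i * \<sigma>"] psd unfolding sum by simp
  moreover have "(P k * \<sigma>) * P k = P k * (\<sigma> * P k)" using psd k by (simp only: assoc_Mn psd_Mn P_simps)
  ultimately have "\<sigma> * P k = P k * \<sigma>" by metis
  then have "(msqrt n \<sigma> * msqrt n \<sigma>) * P k = P k * (msqrt n \<sigma> * msqrt n \<sigma>)" unfolding T(2) .
  then show ?thesis by (rule psd_square_intertwine[OF T(1) T(1) P_simps(1)[OF k]])
qed

text \<open>The unitary that makes R T positive also rotates the projectors into the measurement,
  which therefore depends on \<sigma>.\<close>

lemma fidelity_le_vn_score:
  assumes \<rho>: "density n \<rho>" and \<sigma>: "incoherent \<sigma>"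
  obtains M where "vn_measurement n m M" "(fidelity n \<rho> \<sigma>)\<^sup>2 \<le> score \<rho> M"
proof -
  have psd: "psd n \<rho>" "psd n \<sigma>" and tr: "mtrace \<sigma> = 1"
    using \<rho> \<sigma> by (auto simp: density_def incoherent_def)
  define R T where "R = msqrt n \<rho>" and "T = msqrt n \<sigma>"
  have R: "R \<in> Mn" "cadj R = R" using msqrt_psd[OF psd(1)] by (auto simp: R_def)
  have T: "T \<in> Mn" "cadj T = T" using msqrt_psd[OF psd(2)] by (auto simp: T_def)
  have hsT: "hs_norm2 T = 1" unfolding T_def hs_norm2_msqrt[OF psd(2)] tr by simp
  have comm: "T * P k = P k * T" if "k < m" for k
    unfolding T_def by (rule incoherent_msqrt_commute[OF \<sigma> that])
  obtain U where U: "unitary_mat n U" and pos: "psd n (U * (R * T))"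
    using polar_unitary[of "R * T"] R T by auto
  note UD = unitaryD[OF U]
  define F where "F = fidelity n \<rho> \<sigma>"
  have F: "F = Re (mtrace (U * (R * T)))"
    unfolding F_def R_def T_def by (rule fidelity_polar[OF psd U]) (use pos in \<open>simp add: R_def T_def\<close>)
  define Y where "Y = msum n (\<lambda>i. P i * (U * (R * P i))) {..<m}"
  have Y: "Y \<in> Mn" by (simp add: Y_def)
  \<comment> \<open>T commutes with the projectors, so a trace against T sees only the diagonal
    blocks of U R, and Y may replace U R.\<close>
  have "mtrace (Y * T) = (\<Sum>i<m. mtrace (P i * (U * (R * (P i * T)))))"
    unfolding Y_def using UD R T by (subst msum_mult) (auto simp: mtrace_msum assoc_Mn)
  also have "\<dots> = (\<Sum>i<m. mtrace ((U * (R * T)) * P i))"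
  proof (intro sum.cong refl)
    fix i assume "i \<in> {..<m}"
    then have i: "i < m" by simp
    have "mtrace (P i * (U * (R * (P i * T)))) = mtrace ((U * (R * (P i * T))) * P i)"
      using UD R T i by (intro mtrace_comm_Mn) auto
    also have "(U * (R * (P i * T))) * P i = (U * (R * T)) * P i"
      using UD R T i comm by (simp add: assoc_Mn P_mult_left)
    finally show "mtrace (P i * (U * (R * (P i * T)))) = mtrace ((U * (R * T)) * P i)" .
  qed
  also have "\<dots> = mtrace (msum n (\<lambda>i. (U * (R * T)) * P i) {..<m})"
    using UD R T by (subst mtrace_msum) auto
  also have "msum n (\<lambda>i. (U * (R * T)) * P i) {..<m} = U * (R * T)"
    using UD R T by (subst mult_msum[symmetric]) (auto simp: msum_P)
  finally have trYT: "Re (mtrace (Y * T)) = F" unfolding F by simp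
  \<comment> \<open>The norm of T is 1, so F T is the real multiple of T closest to
    \<open>cadj Y\<close>. Expanding the squared norm of the difference leaves
    \<open>hs_norm2 Y\<close> - F^2, which is nonnegative.\<close>
  define T' where "T' = complex_of_real (- F) \<cdot>\<^sub>m T"
  have T': "T' \<in> Mn" using T by (simp add: T'_def)
  have "Y * T' = complex_of_real (- F) \<cdot>\<^sub>m (Y * T)" unfolding T'_def by (rule mult_smult_distrib[OF Y T(1)])
  then have "Re (mtrace (Y * T')) = - (F * F)"
    using mtrace_smult[of "Y * T" "complex_of_real (- F)"] Y T trYT by simp
  moreover have "hs_norm2 T' = F\<^sup>2" unfolding T'_def hs_norm2_smult[OF T(1)] hsT by simp
  moreover have "0 \<le> hs_norm2 (cadj Y + T')" using Y T' by (intro hs_norm2_nonneg) auto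
  ultimately have "F\<^sup>2 \<le> hs_norm2 Y"
    using hs_norm2_add[of "cadj Y" T'] Y T' by (simp add: hs_norm2_cadj power2_eq_square)
  also have "\<dots> = (\<Sum>i<m. hs_norm2 (P i * (U * (R * P i))))"
    unfolding Y_def using UD R by (intro hs_norm2_msum_proj) auto
  \<comment> \<open>Each rotated projector is the Gram matrix of P_i U, so the squared norms of the
    blocks of Y are its success terms.\<close>
  also have "\<dots> = (\<Sum>i<m. Re (mtrace (cadj U * (P i * U) * (R * P i * R))))"
  proof (intro sum.cong refl)
    fix i assume "i \<in> {..<m}"
    then have i: "i < m" by simp
    have "cadj U * (P i * U) = cadj (P i * U) * (P i * U)"
      using UD i by (simp add: cadj_Mn assoc_Mn P_mult_left)
    then show "hs_norm2 (P i * (U * (R * P i))) = Re (mtrace (cadj U * (P i * U) * (R * P i * R)))"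
      using trace_gram_conj_proj[of "P i * U" R "P i"] UD R i by (simp add: assoc_Mn)
  qed
  also have "\<dots> = score \<rho> (\<lambda>i. cadj U * (P i * U))" by (simp add: score_def R_def)
  finally show ?thesis using conjugated_vn[OF U] that unfolding F_def by blast
qed

text \<open>Dephasing \<rho> gives such a state. It makes the set under the real \<open>Inf\<close>
  nonempty and is the fallback when a score vanishes.\<close>

lemma incoherent_exists:
  assumes \<rho>: "density n \<rho>" shows "\<exists>\<sigma>. incoherent \<sigma>"
proof -
  have psd: "psd n \<rho>" and tr: "mtrace \<rho> = 1" using \<rho> by (auto simp: density_def)
  note R = msqrt_psd[OF psd]
  define \<sigma> where "\<sigma> = msum n (\<lambda>i. P i * (\<rho> * P i)) {..<m}"
  have "P i * (\<rho> * P i) = cadj (msqrt n \<rho> * P i) * (msqrt n \<rho> * P i)" if "i < m" for i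
  proof -
    have "P i * ((msqrt n \<rho> * msqrt n \<rho>) * P i) = cadj (msqrt n \<rho> * P i) * (msqrt n \<rho> * P i)"
      using R(1) that by (simp add: cadj_Mn assoc_Mn)
    then show ?thesis unfolding R(2) .
  qed
  then have "psd n (P i * (\<rho> * P i))" if "i < m" for i using psd_gram[of "msqrt n \<rho> * P i"] R that by simp
  then have "psd n \<sigma>" unfolding \<sigma>_def by (intro psd_msum) auto
  moreover have "mtrace \<sigma> = 1"
  proof -
    have "mtrace \<sigma> = (\<Sum>i<m. mtrace (P i * (\<rho> * P i)))"
      unfolding \<sigma>_def using psd by (intro mtrace_msum) auto
    also have "\<dots> = (\<Sum>i<m. mtrace (\<rho> * P i))"
      using psd by (intro sum.cong refl, subst mtrace_comm_Mn) (auto simp: assoc_Mn)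
    also have "\<dots> = mtrace (msum n (\<lambda>i. \<rho> * P i) {..<m})" using psd by (subst mtrace_msum) auto
    also have "\<dots> = 1" using psd tr by (subst mult_msum[symmetric]) (auto simp: msum_P)
    finally show ?thesis .
  qed
  moreover have "msum n (\<lambda>i. P i * \<sigma> * P i) {..<m} = \<sigma>"
  proof -
    have "P i * \<sigma> * P i = P i * (\<rho> * P i)" if "i < m" for i
      using proj_mult_msum[OF that, of "\<lambda>i. \<rho> * P i"] psd that by (simp add: \<sigma>_def assoc_Mn)
    then show ?thesis unfolding \<sigma>_def[symmetric] by (subst (2) \<sigma>_def) (auto intro!: msum_cong)
  qed
  ultimately show ?thesis unfolding incoherent_def density_def by blast
qed

text \<open>The roots of the M_i need not have orthogonal ranges, but stacked along the blocks P_i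
  they become one contraction, so a POVM can serve where the converse bound produces
  projectors.\<close>

lemma povm_score_le_fidelity:
  assumes \<rho>: "density n \<rho>" and M: "povm n m M"
  obtains \<sigma> where "incoherent \<sigma>" "score \<rho> M \<le> (fidelity n \<rho> \<sigma>)\<^sup>2"
proof (cases "score \<rho> M > 0")
  \<comment> \<open>Normalising by 1 / sqrt s needs a positive score; otherwise any incoherent state
    satisfies the bound.\<close>
  case False
  with incoherent_exists[OF \<rho>] that show ?thesis
    by (meson le_less_trans not_le zero_le_power2 order_trans)
next
  case True
  have psd: "psd n \<rho>" using \<rho> by (simp add: density_def)
  define R where "R = msqrt n \<rho>"
  define L where "L = (\<lambda>i. msqrt n (M i))"
  have R: "R \<in> Mn" "cadj R = R" using msqrt_psd[OF psd] by (auto simp: R_def)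
  have L: "L i \<in> Mn" if "i < m" for i
    using msqrt_psd[of "M i"] M that by (auto simp: L_def povm_def)
  define s where "s = score \<rho> M"
  have s: "s = (\<Sum>i<m. hs_norm2 (L i * (R * P i)))"
    unfolding s_def L_def R_def by (rule score_povm[OF psd M])
  have "\<exists>V. unitary_mat n V \<and> psd n (V * (L i * (R * P i)))" if "i < m" for i
    using polar_unitary[of "L i * (R * P i)"] R L[OF that] that by auto
  then obtain U where U: "\<And>i. i < m \<Longrightarrow> unitary_mat n (U i)"
    and pos: "\<And>i. i < m \<Longrightarrow> psd n (U i * (L i * (R * P i)))" by metis
  have UM: "U i \<in> Mn" if "i < m" for i using unitaryD(1)[OF U[OF that]] .
  define A where "A = (\<lambda>i. U i * (L i * (R * P i)))"
  have A: "psd n (A i)" "A i \<in> Mn" "cadj (A i) = A i" if "i < m" for i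
    using pos[OF that] by (auto simp: A_def)
  \<comment> \<open>The factor P_i ends A_i on the right, and Hermiticity moves it to the left.
    Hence T is block diagonal with the blocks A_i.\<close>
  have AP: "A i * P i = A i" if "i < m" for i using that UM L R by (simp add: A_def assoc_Mn)
  have PA: "P i * A i = A i" if "i < m" for i
    using arg_cong[OF AP[OF that], of cadj] A[OF that] that by (simp add: cadj_Mn)
  define T where "T = msum n A {..<m}"
  have T: "psd n T" unfolding T_def using A by (intro psd_msum) auto
  have T_alt: "T = msum n (\<lambda>i. P i * A i) {..<m}" "T = msum n (\<lambda>i. A i * P i) {..<m}"
    unfolding T_def by (auto intro!: msum_cong simp: PA AP)
  have PT: "P k * T = A k" if "k < m" for k
    unfolding T_alt(1) using proj_mult_msum[OF that, of A] A PA that by simp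
  have TP: "T * P k = A k" if "k < m" for k
    unfolding T_alt(2) using msum_mult_proj[OF that, of A] A AP that by simp
  have hsT: "hs_norm2 T = s"
  proof -
    have "hs_norm2 T = (\<Sum>i<m. hs_norm2 (P i * A i))"
      unfolding T_alt(1) using A by (intro hs_norm2_msum_proj)
    also have "\<dots> = (\<Sum>i<m. hs_norm2 (A i))" by (simp add: PA)
    also have "\<dots> = s" unfolding s A_def using U L R by (simp add: hs_norm2_unitary)
    finally show ?thesis .
  qed
  \<comment> \<open>The squared norm of T is s, and the trace of \<sigma> is the squared norm of its
    root, so this factor gives \<sigma> trace 1.\<close>
  define c where "c = 1 / sqrt s"
  have s0: "s > 0" using True by (simp add: s_def)
  have c: "c \<ge> 0" "c\<^sup>2 * s = 1" using s0 by (auto simp: c_def power_divide)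
  define T' where "T' = complex_of_real c \<cdot>\<^sub>m T"
  have T': "psd n T'" unfolding T'_def by (rule psd_smult[OF T c(1)])
  define \<sigma> where "\<sigma> = T' * T'"
  have \<sigma>: "psd n \<sigma>" unfolding \<sigma>_def using psd_gram[of T'] T' by simp
  have sqrt\<sigma>: "msqrt n \<sigma> = T'" by (rule msqrt_eqI[OF T']) (simp add: \<sigma>_def)
  have "mtrace \<sigma> = complex_of_real (hs_norm2 T')" unfolding \<sigma>_def using mtrace_gram[of T'] T' by simp
  also have "hs_norm2 T' = 1" unfolding T'_def using hs_norm2_smult[of T c] T hsT c by simp
  finally have tr: "mtrace \<sigma> = 1" by simp
  have comm: "P k * T' = T' * P k" if "k < m" for k
    unfolding T'_def using mult_smult_distrib[of "P k" n n T n] mult_smult_assoc_mat[of T n n "P k" n]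
      T that by (simp add: PT TP)
  have "P k * \<sigma> * P k = \<sigma> * P k" if k: "k < m" for k
  proof -
    have "P k * \<sigma> * P k = (P k * T') * (T' * P k)" using T' k by (simp add: \<sigma>_def assoc_Mn)
    also have "\<dots> = (T' * P k) * (P k * T')" by (simp only: comm[OF k])
    also have "\<dots> = T' * (P k * T')" using T' k by (simp add: assoc_Mn P_mult_left)
    also have "\<dots> = \<sigma> * P k" unfolding comm[OF k] using T' k by (simp add: \<sigma>_def assoc_Mn)
    finally show ?thesis .
  qed
  then have "msum n (\<lambda>i. P i * \<sigma> * P i) {..<m} = msum n (\<lambda>i. \<sigma> * P i) {..<m}"
    by (intro msum_cong) auto
  also have "\<dots> = \<sigma>" using \<sigma> by (subst mult_msum[symmetric]) (auto simp: msum_P)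
  finally have inc: "incoherent \<sigma>" using \<sigma> tr by (simp add: incoherent_def density_def)
  define C where "C = msum n (\<lambda>i. P i * (U i * L i)) {..<m}"
  have C: "C \<in> Mn" by (simp add: C_def)
  \<comment> \<open>Pythagoras splits the norm over the blocks, P_i shrinks, U_i preserves, and
    completeness of the POVM restores the norm of Y.\<close>
  have contr: "hs_norm2 (C * Y) \<le> hs_norm2 Y" if Y: "Y \<in> Mn" for Y
  proof -
    have "C * Y = msum n (\<lambda>i. P i * (U i * (L i * Y))) {..<m}"
      unfolding C_def using UM L Y by (subst msum_mult) (auto simp: assoc_Mn intro!: msum_cong)
    then have "hs_norm2 (C * Y) = (\<Sum>i<m. hs_norm2 (P i * (U i * (L i * Y))))"
      using UM L Y by (simp add: hs_norm2_msum_proj)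
    also have "\<dots> \<le> (\<Sum>i<m. hs_norm2 (U i * (L i * Y)))"
      using UM L Y by (intro sum_mono hs_norm2_proj_le) auto
    also have "\<dots> = (\<Sum>i<m. hs_norm2 (L i * Y))" using U L Y by (simp add: hs_norm2_unitary)
    also have "\<dots> = hs_norm2 Y" unfolding L_def by (rule sum_hs_norm2_povm[OF M Y])
    finally show ?thesis .
  qed
  have "C * (R * T) = msum n (\<lambda>i. P i * (U i * (L i * (R * T)))) {..<m}"
    unfolding C_def using UM L R T by (subst msum_mult) (auto simp: assoc_Mn intro!: msum_cong)
  then have "mtrace (C * (R * T)) = (\<Sum>i<m. mtrace (P i * (U i * (L i * (R * T)))))"
    using UM L R T by (simp add: mtrace_msum)
  \<comment> \<open>Cyclicity moves P_i next to T, and T P_i = A_i = P_i A_i supplies the projector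
    that turns U_i L_i R into A_i.\<close>
  also have "\<dots> = (\<Sum>i<m. mtrace (cadj (A i) * A i))"
  proof (intro sum.cong refl)
    fix i assume "i \<in> {..<m}"
    then have i: "i < m" by simp
    have "mtrace (P i * (U i * (L i * (R * T)))) = mtrace ((U i * (L i * (R * T))) * P i)"
      using UM L R T i by (intro mtrace_comm_Mn) auto
    also have "(U i * (L i * (R * T))) * P i = U i * (L i * (R * (P i * A i)))"
      using UM L R T i by (simp add: assoc_Mn TP PA)
    also have "\<dots> = A i * A i"
    proof -
      have "A i * A i = (U i * (L i * (R * P i))) * A i" by (simp only: A_def)
      also have "\<dots> = U i * (L i * (R * (P i * A i)))"
        using UM[OF i] L[OF i] R A(2)[OF i] i by (simp add: assoc_Mn)
      finally show ?thesis by simp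
    qed
    finally show "mtrace (P i * (U i * (L i * (R * T)))) = mtrace (cadj (A i) * A i)"
      using A i by simp
  qed
  also have "\<dots> = complex_of_real (\<Sum>i<m. hs_norm2 (A i))"
    unfolding of_real_sum by (intro sum.cong refl mtrace_gram) (use A in auto)
  also have "(\<Sum>i<m. hs_norm2 (A i)) = s"
    unfolding s A_def using U L R by (simp add: hs_norm2_unitary)
  finally have trC: "mtrace (C * (R * T)) = complex_of_real s" .
  have "C * (R * T') = complex_of_real c \<cdot>\<^sub>m (C * (R * T))"
    unfolding T'_def using mult_smult_distrib[of R n n T n] mult_smult_distrib[of C n n "R * T" n] C R T
    by simp
  then have "Re (mtrace (C * (R * T'))) = c * s"
    using mtrace_smult[of "C * (R * T)" "complex_of_real c"] C R T trC by simp
  also have "\<dots> = sqrt s" using s0 by (simp add: c_def real_div_sqrt)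
  finally have "sqrt s \<le> fidelity n \<rho> \<sigma>"
    using contraction_le_fidelity[OF psd \<sigma> C contr] unfolding sqrt\<sigma> R_def[symmetric] by simp
  then have "(sqrt s)\<^sup>2 \<le> (fidelity n \<rho> \<sigma>)\<^sup>2" by (intro power_mono) (use s0 in auto)
  then have "score \<rho> M \<le> (fidelity n \<rho> \<sigma>)\<^sup>2" using s0 by (simp add: s_def)
  with inc show ?thesis by (rule that)
qed

text \<open>The circle 1 - I \<le> V \<le> S \<le> 1 - I closes: its outer links are the two
  fidelity bounds, and the middle one holds because von Neumann measurements are POVMs.\<close>

lemma max_fidelity_eq_max_score:
  assumes \<rho>: "density n \<rho>"
  shows "Inf ((\<lambda>\<sigma>. 1 - (fidelity n \<rho> \<sigma>)\<^sup>2) ` Collect incoherent)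
      = 1 - Sup (score \<rho> ` {M. vn_measurement n m M})" (is "?I = 1 - ?V")
    and "Inf ((\<lambda>\<sigma>. 1 - (fidelity n \<rho> \<sigma>)\<^sup>2) ` Collect incoherent)
      = 1 - Sup (score \<rho> ` {M. povm n m M})" (is "_ = 1 - ?S")
proof -
  have sub: "povm n m M" if "vn_measurement n m M" for M
    using projective_measurement.povm_of_vn[of n m M] that by (simp add: projective_measurement_def)
  have bdd: "bdd_above (score \<rho> ` {M. povm n m M})"
    by (rule bdd_aboveI[of _ 1]) (use score_le_one[OF \<rho>] in auto)
  have bddv: "bdd_above (score \<rho> ` {M. vn_measurement n m M})"
    by (rule bdd_above_mono[OF bdd]) (use sub in auto)
  have le: "1 - ?V \<le> 1 - (fidelity n \<rho> \<sigma>)\<^sup>2" if \<sigma>: "incoherent \<sigma>" for \<sigma>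
  proof -
    obtain M where M: "vn_measurement n m M" "(fidelity n \<rho> \<sigma>)\<^sup>2 \<le> score \<rho> M"
      using fidelity_le_vn_score[OF \<rho> \<sigma>] by metis
    have "score \<rho> M \<le> ?V" by (rule cSup_upper) (use M bddv in auto)
    then show ?thesis using M by simp
  qed
  have 1: "1 - ?V \<le> ?I" using incoherent_exists[OF \<rho>] le by (intro cINF_greatest) auto
  have "bdd_below ((\<lambda>\<sigma>. 1 - (fidelity n \<rho> \<sigma>)\<^sup>2) ` Collect incoherent)"
    by (rule bdd_belowI[of _ "1 - ?V"]) (use le in auto)
  then have ge: "score \<rho> M \<le> 1 - ?I" if M: "povm n m M" for M
  proof -
    obtain \<sigma> where \<sigma>: "incoherent \<sigma>" "score \<rho> M \<le> (fidelity n \<rho> \<sigma>)\<^sup>2"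
      using povm_score_le_fidelity[OF \<rho> M] by metis
    have "?I \<le> 1 - (fidelity n \<rho> \<sigma>)\<^sup>2"
      by (rule cINF_lower) (use \<sigma> \<open>bdd_below _\<close> in auto)
    then show ?thesis using \<sigma> by simp
  qed
  have 2: "?S \<le> 1 - ?I" using ge povm_of_vn by (intro cSUP_least) auto
  have 3: "?V \<le> ?S" using vn bdd sub by (intro cSup_subset_mono) auto
  show "?I = 1 - ?V" "?I = 1 - ?S" using 1 2 3 by auto
qed

end

section \<open>Lueders projectors in Kronecker coordinates and their ensemble\<close>

lemma sum_div_mod:
  fixes f :: "nat \<Rightarrow> nat \<Rightarrow> 'a::comm_monoid_add"
  shows "(\<Sum>l<p*q. f (l div q) (l mod q)) = (\<Sum>a<p. \<Sum>b<q. f a b)"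
  unfolding sum.cartesian_product
proof (rule sum.reindex_bij_witness[of _ "\<lambda>(a,b). a * q + b" "\<lambda>l. (l div q, l mod q)"])
  fix ab assume "ab \<in> {..<p} \<times> {..<q}"
  then obtain a b where ab: "ab = (a,b)" "a < p" "b < q" by auto
  have "a * q + b < Suc a * q" using ab by simp
  also have "\<dots> \<le> p * q" using ab by (intro mult_le_mono1) simp
  finally show "(case ab of (a,b) \<Rightarrow> a * q + b) \<in> {..<p*q}" using ab by simp
  show "((case ab of (a,b) \<Rightarrow> a * q + b) div q, (case ab of (a,b) \<Rightarrow> a * q + b) mod q) = ab"
    using ab by simp
next
  fix l assume "l \<in> {..<p*q}"
  then have l: "l < p * q" by simp
  then have "q > 0" by (cases q) auto
  then show "(l div q, l mod q) \<in> {..<p} \<times> {..<q}" using l by (simp add: less_mult_imp_div_less)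
  show "(case (l div q, l mod q) of (a,b) \<Rightarrow> a * q + b) = l" by (simp only: prod.case div_mult_mod_eq)
  show "(case (l div q, l mod q) of (a,b) \<Rightarrow> f a b) = f (l div q) (l mod q)" by (simp only: prod.case)
qed

text \<open>Orthonormality of the basis gives the products of the projectors, its completeness gives
  their sum.\<close>

lemma lproj_vn:
  assumes e: "orthonormal_basis na e" shows "vn_measurement (na*nb) na (lproj nb e)"
proof -
  interpret square_matrices "na*nb" .
  have ec: "e i \<in> carrier_vec na" if "i < na" for i using e that by (simp add: orthonormal_basis_def)
  have on: "e i \<bullet>c e j = (if i = j then 1 else 0)" if "i < na" "j < na" for i j
    using e that by (simp add: orthonormal_basis_def)
  have M: "lproj nb e i \<in> Mn" if "i < na" for i
    using ec[OF that] by (auto simp: lproj_def kron_def outer_def)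
  have ix: "lproj nb e i $$ (r,c) = (if r mod nb = c mod nb then e i $ (r div nb) * cnj (e i $ (c div nb)) else 0)"
    if "i < na" "r < na*nb" "c < na*nb" for i r c
  proof -
    have "nb > 0" using that(2) by (auto intro: gr0I)
    then show ?thesis using that ec[OF that(1)]
      by (auto simp: lproj_def kron_def outer_def less_mult_imp_div_less)
  qed
  have prod: "lproj nb e i * lproj nb e j = (if i = j then lproj nb e i else 0\<^sub>m (na*nb) (na*nb))"
    if ij: "i < na" "j < na" for i j
  proof (rule mat_eqI)
    fix r c assume rc: "r < na*nb" "c < na*nb"
    have nb: "nb > 0" using rc(1) by (auto intro: gr0I)
    \<comment> \<open>The identity on the second factor fixes the second index of the summation
      variable; a guard on b expresses this, so that \<open>sum_div_mod\<close> applies.\<close>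
    define f where "f = (\<lambda>a b. if b = r mod nb then
       (if r mod nb = c mod nb then e i $ (r div nb) * cnj (e j $ (c div nb)) * (e j $ a * cnj (e i $ a)) else 0) else 0)"
    have "(lproj nb e i * lproj nb e j) $$ (r,c) = (\<Sum>l<na*nb. f (l div nb) (l mod nb))"
      using M ij rc by (subst mult_index_Mn) (auto simp: ix f_def intro!: sum.cong)
    also have "\<dots> = (\<Sum>a<na. \<Sum>b<nb. f a b)" by (rule sum_div_mod)
    also have "\<dots> = (\<Sum>a<na. if r mod nb = c mod nb then e i $ (r div nb) * cnj (e j $ (c div nb)) * (e j $ a * cnj (e i $ a)) else 0)"
      using nb by (simp add: f_def)
    also have "\<dots> = (if r mod nb = c mod nb then e i $ (r div nb) * cnj (e j $ (c div nb)) * (e j \<bullet>c e i) else 0)"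
      unfolding cscalar_prod_sum[OF ec[OF ij(1)]] by (simp add: sum_distrib_left)
    also have "\<dots> = (if i = j then lproj nb e i else 0\<^sub>m (na*nb) (na*nb)) $$ (r,c)"
      using ij rc on by (auto simp: ix)
    finally show "(lproj nb e i * lproj nb e j) $$ (r,c) = (if i = j then lproj nb e i else 0\<^sub>m (na*nb) (na*nb)) $$ (r,c)" .
  qed (use M ij in auto)
  have adj: "cadj (lproj nb e i) = lproj nb e i" if i: "i < na" for i
    by (rule mat_eqI) (use M[OF i] i in \<open>auto simp: cadj_index[OF M[OF i]] ix\<close>)
  interpret a: square_matrices na .
  define V where "V = mat na na (\<lambda>(i,j). e j $ i)"
  have V: "unitary_mat na V" unfolding V_def by (rule a.unitary_of_orthonormal) (use ec on in auto)
  \<comment> \<open>Completeness is the half V \<open>cadj V\<close> = 1 of unitarity, whereas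
    orthonormality is the other half.\<close>
  have complete: "(\<Sum>i<na. e i $ a * cnj (e i $ b)) = (if a = b then 1 else 0)" if ab: "a < na" "b < na" for a b
  proof -
    have "(\<Sum>i<na. e i $ a * cnj (e i $ b)) = (V * cadj V) $$ (a,b)"
      using ab a.unitaryD(1,2)[OF V]
      by (subst a.mult_index_Mn) (auto simp: cadj_index[of _ na na], auto simp: V_def)
    also have "\<dots> = (if a = b then 1 else 0)" unfolding a.unitaryD(4)[OF V] using ab by simp
    finally show ?thesis .
  qed
  have sum: "msum (na*nb) (lproj nb e) {..<na} = 1\<^sub>m (na*nb)"
  proof (rule mat_eqI)
    fix r c assume rc: "r < na*nb" "c < na*nb"
    have "msum (na*nb) (lproj nb e) {..<na} $$ (r,c)
        = (if r mod nb = c mod nb then \<Sum>i<na. e i $ (r div nb) * cnj (e i $ (c div nb)) else 0)"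
      using rc by (simp add: msum_index ix)
    also have "\<dots> = (if r mod nb = c mod nb \<and> r div nb = c div nb then 1 else 0)"
      using rc by (simp add: complete less_mult_imp_div_less)
    also have "\<dots> = (if r = c then 1 else 0)" by (metis div_mult_mod_eq)
    finally show "msum (na*nb) (lproj nb e) {..<na} $$ (r,c) = 1\<^sub>m (na*nb) $$ (r,c)" using rc by simp
  qed auto
  show ?thesis unfolding vn_measurement_def using M adj prod sum by auto
qed

lemma succ_prob_ensemble:
  assumes \<rho>: "density (na*nb) \<rho>" and e: "orthonormal_basis na e" and M: "povm (na*nb) na M"
  shows "succ_prob na (eta_ens nb e \<rho>) (omega_ens na nb e \<rho>) M
    = projective_measurement.score (na*nb) na (lproj nb e) \<rho> M"
proof -
  interpret projective_measurement "na*nb" na "lproj nb e"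
    by unfold_locales (rule lproj_vn[OF e])
  have psd: "psd (na*nb) \<rho>" using \<rho> by (simp add: density_def)
  define R where "R = msqrt (na*nb) \<rho>"
  have R: "psd (na*nb) R" "R * R = \<rho>" using msqrt_psd[OF psd] by (auto simp: R_def)
  have "eta_ens nb e \<rho> i * Re (mtrace (M i * omega_ens na nb e \<rho> i))
      = Re (mtrace (M i * (R * lproj nb e i * R)))" if i: "i < na" for i
  proof -
    let ?P = "lproj nb e i"
    have Mi: "psd (na*nb) (M i)" using M i by (simp add: povm_def)
    have X: "R * ?P * R \<in> Mn" using R i by simp
    \<comment> \<open>As a squared norm the prior is never negative, so a prior that is not positive
      is zero.\<close>
    have eta: "eta_ens nb e \<rho> i = hs_norm2 (R * ?P)"
    proof -
      have "mtrace (?P * \<rho>) = mtrace (cadj (R * ?P) * (R * ?P))"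
      proof -
        have "mtrace (?P * \<rho>) = mtrace ((?P * (?P * R)) * R)"
          using R(1) i by (simp add: R(2)[symmetric] assoc_Mn P_mult_left)
        also have "\<dots> = mtrace (((?P * R) * R) * ?P)"
          using R(1) i mtrace_comm_Mn[of ?P "(?P * R) * R"] by (simp add: assoc_Mn)
        also have "((?P * R) * R) * ?P = cadj (R * ?P) * (R * ?P)"
          using R(1) i by (simp add: cadj_Mn assoc_Mn)
        finally show ?thesis .
      qed
      then show ?thesis by (simp add: eta_ens_def hs_norm2_def)
    qed
    show ?thesis
    proof (cases "eta_ens nb e \<rho> i > 0")
      case True
      then have "M i * omega_ens na nb e \<rho> i
          = complex_of_real (1 / eta_ens nb e \<rho> i) \<cdot>\<^sub>m (M i * (R * ?P * R))"
        unfolding omega_ens_def R_def[symmetric] using mult_smult_distrib[OF psd_Mn[OF Mi] X] by simp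
      then have "mtrace (M i * omega_ens na nb e \<rho> i)
          = complex_of_real (1 / eta_ens nb e \<rho> i) * mtrace (M i * (R * ?P * R))"
        using mtrace_smult[of "M i * (R * ?P * R)"] Mi X by simp
      then show ?thesis using True by simp
    next
      \<comment> \<open>Here \<open>omega_ens\<close> is 0 by convention. The score term agrees: it
        is at most the squared norm of R P_i, which is the vanishing prior.\<close>
      case False
      moreover have "hs_norm2 (R * ?P) \<ge> 0" using R i by (intro hs_norm2_nonneg) simp
      ultimately have 0: "hs_norm2 (R * ?P) = 0" using eta by simp
      have "Re (mtrace (M i * (R * ?P * R))) = hs_norm2 (msqrt (na*nb) (M i) * (R * ?P))"
        unfolding R_def by (rule trace_povm_element[OF psd Mi i])
      moreover have "hs_norm2 (msqrt (na*nb) (M i) * (R * ?P)) \<le> 0" using povm_element_hs_le[OF M _ i, of "R * ?P"] 0 R i by simp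
      moreover have "hs_norm2 (msqrt (na*nb) (M i) * (R * ?P)) \<ge> 0" using msqrt_psd[OF Mi] R i by (intro hs_norm2_nonneg) simp
      ultimately show ?thesis using eta 0 by simp
    qed
  qed
  then show ?thesis unfolding succ_prob_def score_def R_def by simp
qed

theorem theorem3:
  fixes na nb :: nat and e :: "nat \<Rightarrow> complex vec" and \<rho> :: "complex mat"
  assumes "density (na*nb) \<rho>"
    and "orthonormal_basis na e"
  shows "fid_partial_coherence na nb e \<rho>
           = opt_error_vN (na*nb) na (eta_ens nb e \<rho>) (omega_ens na nb e \<rho>)
         \<and> fid_partial_coherence na nb e \<rho>
           \<ge> opt_error (na*nb) na (eta_ens nb e \<rho>) (omega_ens na nb e \<rho>)
         \<and> (lin_indep_states (na*nb) {i. i < na \<and> eta_ens nb e \<rho> i > 0} (omega_ens na nb e \<rho>) \<longrightarrow>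
            fid_partial_coherence na nb e \<rho>
              = opt_error (na*nb) na (eta_ens nb e \<rho>) (omega_ens na nb e \<rho>))"
proof -
  interpret projective_measurement "na*nb" na "lproj nb e"
    by unfold_locales (rule lproj_vn[OF assms(2)])
  note succ = succ_prob_ensemble[OF assms]
  have vn_povm: "povm (na*nb) na M" if "vn_measurement (na*nb) na M" for M
    using projective_measurement.povm_of_vn[of "na*nb" na M] that by (simp add: projective_measurement_def)
  have coh: "fid_partial_coherence na nb e \<rho>
      = Inf ((\<lambda>\<sigma>. 1 - (fidelity (na*nb) \<rho> \<sigma>)\<^sup>2) ` Collect incoherent)"
    unfolding fid_partial_coherence_def partial_incoherent_def incoherent_def ..
  have err: "opt_error (na*nb) na (eta_ens nb e \<rho>) (omega_ens na nb e \<rho>)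
      = 1 - Sup (score \<rho> ` {M. povm (na*nb) na M})"
    unfolding opt_error_def
    by (intro arg_cong[of _ _ "\<lambda>A. 1 - Sup A"] image_cong) (use succ in auto)
  have err_vN: "opt_error_vN (na*nb) na (eta_ens nb e \<rho>) (omega_ens na nb e \<rho>)
      = 1 - Sup (score \<rho> ` {M. vn_measurement (na*nb) na M})"
    unfolding opt_error_vN_def
    by (intro arg_cong[of _ _ "\<lambda>A. 1 - Sup A"] image_cong) (use succ vn_povm in auto)
  show ?thesis
    unfolding err err_vN coh using max_fidelity_eq_max_score[OF assms(1)] by simp
qed

end
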